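(* Let $x_1,\dots,x_N\in[0,1]$ be the nodes of the interpolation formula and let $z\in[0,1]$. The system of linear equations in the unknowns $C_1(z),\dots,C_N(z),\lambda$ $$\sum_{k=1}^N C_k(z)B_{2m}(x_{k'}-x_k)+\lambda=B_{2m}(z-x_{k'}),\quad k'=1,\dots,N,\qquad \sum_{k=1}^N C_k(z)=1,$$ has a unique solution, and this solution gives the minimum of $\|\ell\,|\,\widetilde{L_2^{(m)*}}(0,1)\|^2$ under the condition $\sum_{k=1}^N C_k(z)=1$.
   Context: Here $m\ge1$ and $N\ge1$ are integers and $B_{2m}(x)=\sum_{\beta\in\mathbb{Z},\,\beta\ne0}\frac{\exp(-2\pi i\beta x)}{(2\pi i\beta)^{2m}}$. $\widetilde{L_2^{(m)}}(0,1)$ is the Hilbert space of 1-periodic functions $\varphi$ on $\mathbb{R}$ with locally summable derivatives up to order $m$ and $\int_0^1(\varphi^{(m)}(x))^2dx<\infty$, where functions differing by a constant are identified, with norm $\|\varphi\|=\left(\int_0^1(\varphi^{(m)}(x))^2dx\right)^{1/2}$. The interpolation formula is $\varphi(x)\cong\sum_{k=1}^N C_k(x)\varphi(x_k)$, where the points $x_k\in[0,1]$ are called its nodes and the $C_k(x)$ its coefficients. Its error functional at the point $z$ is $(\ell,\varphi)=\varphi(z)-\sum_{k=1}^N C_k(z)\varphi(x_k)$; under $\sum_{k=1}^N C_k(z)=1$ it belongs to the dual space $\widetilde{L_2^{(m)*}}(0,1)$, with norm $\sup_{\|\varphi\|=1}|(\ell,\varphi)|$.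
   Formalization: The nodes are additionally assumed pairwise distinct modulo 1 (no repeated nodes, and not both 0 and 1 among them); if two nodes coincide modulo 1, the system has two equal columns and the solution is not unique. *)

theory Defs
  imports "HOL-Analysis.Analysis"
begin

(* The series converges absolutely for n >= 2.  For even n its values are real, although the
   type is complex. *)
definition periodic_B :: "nat \<Rightarrow> real \<Rightarrow> complex" where
  "periodic_B n x =
     (\<Sum>\<^sub>\<infinity>\<beta>\<in>{\<beta>::int. \<beta> \<noteq> 0}.
        exp (- 2 * of_real pi * \<i> * of_int \<beta> * of_real x) / (2 * of_real pi * \<i> * of_int \<beta>) ^ n)"

(* f is locally absolutely continuous with derivative g.  Since the functions are evaluated at
   points, a function with a locally summable generalized derivative is understood to be its
   continuous representative, i.e. the indefinite integral of that derivative. *)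
definition loc_summable_deriv :: "(real \<Rightarrow> real) \<Rightarrow> (real \<Rightarrow> real) \<Rightarrow> bool" where
  "loc_summable_deriv f g \<longleftrightarrow>
     (\<forall>a b. a \<le> b \<longrightarrow> g absolutely_integrable_on {a..b} \<and> (g has_integral (f b - f a)) {a..b})"

primrec has_nth_deriv :: "nat \<Rightarrow> (real \<Rightarrow> real) \<Rightarrow> (real \<Rightarrow> real) \<Rightarrow> bool" where
  "has_nth_deriv 0 f g \<longleftrightarrow> g = f"
| "has_nth_deriv (Suc n) f g \<longleftrightarrow> (\<exists>h. has_nth_deriv n f h \<and> loc_summable_deriv h g)"

(* The choice is immaterial below: an n-th derivative is determined up to a null set. *)
definition nth_deriv :: "nat \<Rightarrow> (real \<Rightarrow> real) \<Rightarrow> real \<Rightarrow> real" where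
  "nth_deriv n f = (SOME g. has_nth_deriv n f g)"

(* The functions representing the elements of the Hilbert space.  Its elements are the classes
   modulo constants; sobolev_norm and, when the coefficients sum to 1, error_functional do not
   depend on the representative (sobolev_norm_add_const, error_functional_add_const), so the
   supremum in dual_norm may be taken over representatives. *)
definition periodic_sobolev :: "nat \<Rightarrow> (real \<Rightarrow> real) set" where
  "periodic_sobolev m =
     {\<phi>. (\<forall>t. \<phi> (t + 1) = \<phi> t) \<and> (\<exists>g. has_nth_deriv m \<phi> g) \<and>
         (\<lambda>t. (nth_deriv m \<phi> t)\<^sup>2) integrable_on {0..1}}"

definition sobolev_norm :: "nat \<Rightarrow> (real \<Rightarrow> real) \<Rightarrow> real" where
  "sobolev_norm m \<phi> = sqrt (integral {0..1} (\<lambda>t. (nth_deriv m \<phi> t)\<^sup>2))"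

(* Valued in ennreal, so that an unbounded functional has norm infinity. *)
definition dual_norm :: "nat \<Rightarrow> ((real \<Rightarrow> real) \<Rightarrow> real) \<Rightarrow> ennreal" where
  "dual_norm m l = (SUP \<phi>\<in>{\<phi> \<in> periodic_sobolev m. sobolev_norm m \<phi> = 1}. ennreal \<bar>l \<phi>\<bar>)"

definition error_functional ::
    "real ^ 'n \<Rightarrow> real \<Rightarrow> real ^ 'n \<Rightarrow> (real \<Rightarrow> real) \<Rightarrow> real" where
  "error_functional x z C \<phi> = \<phi> z - (\<Sum>k\<in>UNIV. C $ k * \<phi> (x $ k))"

definition interpolation_system ::
    "nat \<Rightarrow> real ^ 'n \<Rightarrow> real \<Rightarrow> real ^ 'n \<Rightarrow> real \<Rightarrow> bool" where
  "interpolation_system m x z C \<mu> \<longleftrightarrow>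
     (\<forall>k'. (\<Sum>k\<in>UNIV. of_real (C $ k) * periodic_B (2 * m) (x $ k' - x $ k)) + of_real \<mu>
            = periodic_B (2 * m) (z - x $ k')) \<and>
     (\<Sum>k\<in>UNIV. C $ k) = 1"

lemma has_nth_deriv_add_const:
  "has_nth_deriv (Suc n) (\<lambda>t. \<phi> t + c) g \<longleftrightarrow> has_nth_deriv (Suc n) \<phi> g"
proof (induction n arbitrary: g)
  case 0
  show ?case by (simp add: loc_summable_deriv_def)
next
  case (Suc n)
  show ?case
    unfolding has_nth_deriv.simps(2)[of "Suc n"] Suc.IH ..
qed

lemma nth_deriv_add_const:
  assumes "m \<ge> 1"
  shows "nth_deriv m (\<lambda>t. \<phi> t + c) = nth_deriv m \<phi>"
proof -
  from assms obtain n where "m = Suc n" by (cases m) auto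
  then show ?thesis
    by (simp only: nth_deriv_def has_nth_deriv_add_const)
qed

lemma sobolev_norm_add_const:
  "m \<ge> 1 \<Longrightarrow> sobolev_norm m (\<lambda>t. \<phi> t + c) = sobolev_norm m \<phi>"
  by (simp add: sobolev_norm_def nth_deriv_add_const)

lemma error_functional_add_const:
  assumes "(\<Sum>k\<in>UNIV. C $ k) = 1"
  shows "error_functional x z C (\<lambda>t. \<phi> t + c) = error_functional x z C \<phi>"
  using assms
  by (simp add: error_functional_def distrib_left sum.distrib flip: sum_distrib_right)

end

theory Submission
  imports Defs "HOL-Real_Asymp.Real_Asymp"
begin

text \<open>
  Let \<open>b\<^sub>n\<close> be the real value of the series \<open>B\<^sub>n\<close>, so that \<open>b\<^sub>n' = - b\<^bsub>n-1\<^esub>\<close> and \<open>b\<^sub>1\<close> is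
  the sawtooth. Integrating by parts \<open>m\<close> times shows that \<open>\<integral> b\<^sub>m(t - y) \<phi>\<^bsup>(m)\<^esup>(t) dt\<close> over a period
  is \<open>\<phi>(y)\<close> minus the mean of \<open>\<phi>\<close>. Hence, up to the sign \<open>(-1)\<^sup>m\<close>, the function
  \<open>\<psi>(t) = b\<^bsub>2m\<^esub>(t - z) - \<Sum> C\<^sub>k b\<^bsub>2m\<^esub>(t - x\<^sub>k)\<close> represents the error functional of \<open>C\<close> in the
  Sobolev inner product, and the squared norm of that functional is \<open>\<parallel>\<psi>\<parallel>\<^sup>2\<close>. The linear system says
  that \<open>\<psi>\<close> takes one and the same value \<open>\<lambda>\<close> at all nodes; therefore every error functional with
  coefficients of sum 1 takes the same value at \<open>\<psi>\<close>, and none can have smaller norm.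

  The system is uniquely solvable because \<open>(-1)\<^sup>m \<Sum> C\<^sub>j C\<^sub>k b\<^bsub>2m\<^esub>(x\<^sub>j - x\<^sub>k)\<close> is a positively weighted sum
  of the squares \<open>\<bar>\<Sum> C\<^sub>k exp(2\<pi>i\<beta>x\<^sub>k)\<bar>\<^sup>2\<close> over \<open>\<beta> \<noteq> 0\<close>. If it vanishes and \<open>\<Sum> C\<^sub>k = 0\<close> (the case
  \<open>\<beta> = 0\<close>), a Vandermonde argument gives \<open>C = 0\<close>.
\<close>

section \<open>Indefinite integrals of summable functions\<close>

text \<open>\<open>f\<close> is only absolutely continuous. But \<open>u\<close> is
  \<open>L\<close>-Lipschitz and \<open>V\<close> controls the variation of \<open>f\<close>, so the
  defect \<open>D\<close> of the formula changes over \<open>{s..t}\<close> by at most a product of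
  two small increments.\<close>

lemma integral_product_rule:
  fixes u v f g :: "real \<Rightarrow> real"
  assumes "a \<le> b"
    and v: "v absolutely_integrable_on {a..b}" and g: "g absolutely_integrable_on {a..b}"
    and u: "\<And>s t. a \<le> s \<Longrightarrow> s \<le> t \<Longrightarrow> t \<le> b \<Longrightarrow> (v has_integral (u t - u s)) {s..t}"
    and f: "\<And>s t. a \<le> s \<Longrightarrow> s \<le> t \<Longrightarrow> t \<le> b \<Longrightarrow> (g has_integral (f t - f s)) {s..t}"
    and L: "\<And>t. t \<in> {a..b} \<Longrightarrow> \<bar>v t\<bar> \<le> L"
  shows "((\<lambda>t. u t * g t) has_integral (u b * f b - u a * f a - integral {a..b} (\<lambda>t. v t * f t))) {a..b}"
proof -
  have cont: "continuous_on {a..b} U"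
    if "V absolutely_integrable_on {a..b}"
      and "\<And>s t. a \<le> s \<Longrightarrow> s \<le> t \<Longrightarrow> t \<le> b \<Longrightarrow> (V has_integral (U t - U s)) {s..t}" for U V :: "real \<Rightarrow> real"
  proof -
    have "U t = U a + integral {a..t} V" if "t \<in> {a..b}" for t
      using that \<open>\<And>s t. a \<le> s \<Longrightarrow> s \<le> t \<Longrightarrow> t \<le> b \<Longrightarrow> (V has_integral (U t - U s)) {s..t}\<close>[of a t]
      by (simp add: integral_unique)
    moreover have "continuous_on {a..b} (\<lambda>t. U a + integral {a..t} V)"
      by (intro continuous_intros indefinite_integral_continuous_1
            set_lebesgue_integral_eq_integral(1)) fact
    ultimately show ?thesis by (subst continuous_on_cong[OF refl])
  qed
  have prod: "(\<lambda>t. p t * q t) absolutely_integrable_on {a..b}"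
    if "continuous_on {a..b} p" "q absolutely_integrable_on {a..b}" for p q :: "real \<Rightarrow> real"
    using that by (intro absolutely_integrable_bounded_measurable_product_real
        continuous_imp_measurable_on_sets_lebesgue compact_imp_bounded compact_continuous_image) auto
  have cu: "continuous_on {a..b} u" and cf: "continuous_on {a..b} f"
    using cont[OF v u] cont[OF g f] by auto
  have ug: "(\<lambda>t. u t * g t) integrable_on {a..b}" and vf: "(\<lambda>t. v t * f t) integrable_on {a..b}"
    using prod[OF cu g] prod[OF cf v] by (auto simp: mult.commute absolutely_integrable_on_def)
  have ag: "(\<lambda>t. \<bar>g t\<bar>) integrable_on {a..b}"
    using g by (simp add: absolutely_integrable_on_def)
  define V where "V t = integral {a..t} (\<lambda>t. \<bar>g t\<bar>)" for t
  define D where "D t = u t * f t - integral {a..t} (\<lambda>t. v t * f t) - integral {a..t} (\<lambda>t. u t * g t)" for t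
  have sub: "h integrable_on {s..t}" if "h integrable_on {a..b}" "a \<le> s" "t \<le> b" for h :: "real \<Rightarrow> real" and s t
    using that by (meson atLeastatMost_subset_iff integrable_on_subinterval)
  have split: "integral {a..t} h - integral {a..s} h = integral {s..t} h"
    if "h integrable_on {a..b}" "a \<le> s" "s \<le> t" "t \<le> b" for h :: "real \<Rightarrow> real" and s t
    using Henstock_Kurzweil_Integration.integral_combine[OF that(2,3) sub[OF that(1) order_refl that(4)]] by simp
  have L0: "0 \<le> L" using L[of a] \<open>a \<le> b\<close> by auto
  \<comment> \<open>As \<open>V\<close> is continuous, this quadratic smallness forces \<open>D' = 0\<close> everywhere, although \<open>f\<close> and
    \<open>u\<close> need not be differentiable everywhere.\<close>
  have bound: "\<bar>D t - D s\<bar> \<le> 2 * L * (t - s) * (V t - V s)" if st: "a \<le> s" "s \<le> t" "t \<le> b" for s t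
  proof -
    have iV: "((\<lambda>r. \<bar>g r\<bar>) has_integral (V t - V s)) {s..t}"
      using split[OF ag st] sub[OF ag st(1,3)] by (simp add: V_def has_integral_iff)
    have fV: "\<bar>f r - f s\<bar> \<le> V t - V s" if "r \<in> {s..t}" for r
    proof -
      have "\<bar>f r - f s\<bar> \<le> integral {s..r} (\<lambda>r. \<bar>g r\<bar>)"
        using f[of s r] that st sub[OF ag st(1), of r]
          integral_norm_bound_integral[of g "{s..r}" "\<lambda>r. \<bar>g r\<bar>"] by (auto simp: has_integral_iff)
      also have "\<dots> \<le> integral {s..t} (\<lambda>r. \<bar>g r\<bar>)"
        using that st by (intro integral_subset_le sub[OF ag]) auto
      finally show ?thesis using iV by (simp add: has_integral_iff)
    qed
    have uL: "\<bar>u t - u r\<bar> \<le> L * (t - s)" if "r \<in> {s..t}" for r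
    proof -
      have "norm (u t - u r) \<le> L * measure lborel {r..t}"
        using that st L by (intro has_integral_bound_real[OF L0 finite.emptyI, of v]) (auto intro!: u)
      also have "\<dots> \<le> L * (t - s)"
        using that L0 by (intro mult_left_mono) auto
      finally show ?thesis by simp
    qed
    \<comment> \<open>Freezing \<open>u\<close> at the right end and \<open>f\<close> at the left
      end splits the increment of \<open>u * f\<close> exactly into two terms, each compared with
      one integral.\<close>
    have i1: "((\<lambda>r. (u t - u r) * g r) has_integral (u t * (f t - f s) - integral {s..t} (\<lambda>r. u r * g r))) {s..t}"
      unfolding left_diff_distrib
      by (intro has_integral_diff has_integral_mult_right f integrable_integral sub[OF ug]) (use st in auto)
    have i2: "((\<lambda>r. (f s - f r) * v r) has_integral (f s * (u t - u s) - integral {s..t} (\<lambda>r. v r * f r))) {s..t}"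
      unfolding left_diff_distrib mult.commute[of "f _" "v _"] 
      by (subst mult.commute[of "f s"])
        (intro has_integral_diff has_integral_mult_left u integrable_integral sub[OF vf]; use st in auto)
    have "\<bar>u t * (f t - f s) - integral {s..t} (\<lambda>r. u r * g r)\<bar> \<le> L * (t - s) * (V t - V s)"
    proof -
      have "norm (integral {s..t} (\<lambda>r. (u t - u r) * g r)) \<le> integral {s..t} (\<lambda>r. L * (t - s) * \<bar>g r\<bar>)"
        using i1 iV uL by (intro integral_norm_bound_integral integrable_on_mult_right)
          (auto simp: has_integral_iff abs_mult intro!: mult_right_mono)
      then show ?thesis using i1 iV by (simp add: has_integral_iff)
    qed
    moreover have "\<bar>f s * (u t - u s) - integral {s..t} (\<lambda>r. v r * f r)\<bar> \<le> L * (t - s) * (V t - V s)"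
    proof -
      have "norm (integral {s..t} (\<lambda>r. (f s - f r) * v r)) \<le> integral {s..t} (\<lambda>r. (V t - V s) * L)"
      proof (intro integral_norm_bound_integral)
        fix r assume r: "r \<in> {s..t}"
        show "norm ((f s - f r) * v r) \<le> (V t - V s) * L"
          using mult_mono[OF fV[OF r] L[of r]] r st fV[of s] by (auto simp: abs_mult abs_minus_commute)
      qed (use i2 in \<open>auto simp: has_integral_iff\<close>)
      then show ?thesis using i2 st by (simp add: has_integral_iff mult_ac)
    qed
    moreover have "D t - D s = (u t * (f t - f s) - integral {s..t} (\<lambda>r. u r * g r))
        + (f s * (u t - u s) - integral {s..t} (\<lambda>r. v r * f r))"
      using split[OF ug st] split[OF vf st] by (simp add: D_def algebra_simps)
    ultimately show ?thesis by (simp add: algebra_simps abs_le_iff)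
  qed
  have cV: "continuous_on {a..b} V"
    unfolding V_def by (rule indefinite_integral_continuous_1[OF ag])
  have "(D has_field_derivative 0) (at x within {a..b})" if x: "x \<in> {a..b}" for x
    unfolding has_field_derivative_iff
  proof (rule Lim_null_comparison)
    have "((\<lambda>y. 2 * L * \<bar>V y - V x\<bar>) \<longlongrightarrow> 2 * L * \<bar>V x - V x\<bar>) (at x within {a..b})"
      using cV x unfolding continuous_on_def by (intro tendsto_intros) auto
    then show "((\<lambda>y. 2 * L * \<bar>V y - V x\<bar>) \<longlongrightarrow> 0) (at x within {a..b})" by simp
    show "\<forall>\<^sub>F y in at x within {a..b}. norm ((D y - D x) / (y - x)) \<le> 2 * L * \<bar>V y - V x\<bar>"
      unfolding eventually_at_filter
    proof (intro always_eventually allI impI)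
      fix y assume y: "y \<noteq> x" "y \<in> {a..b}"
      show "norm ((D y - D x) / (y - x)) \<le> 2 * L * \<bar>V y - V x\<bar>"
      proof (cases "x < y")
        case True
        have "\<bar>D y - D x\<bar> \<le> 2 * L * (y - x) * (V y - V x)" using bound[of x y] x y True by auto
        also have "\<dots> \<le> 2 * L * (y - x) * \<bar>V y - V x\<bar>" using L0 True by (intro mult_left_mono) auto
        finally show ?thesis using True by (simp add: abs_mult divide_le_eq algebra_simps)
      next
        case False
        then have F: "y < x" using y by auto
        have "\<bar>D y - D x\<bar> \<le> 2 * L * (x - y) * (V x - V y)"
          using bound[of y x] x y F by (auto simp: abs_minus_commute)
        also have "\<dots> \<le> 2 * L * (x - y) * \<bar>V y - V x\<bar>" using L0 F by (intro mult_left_mono) auto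
        finally show ?thesis using F by (simp add: abs_mult divide_le_eq algebra_simps)
      qed
    qed
  qed
  then have "\<exists>c. \<forall>x\<in>{a..b}. D x = c"
    by (intro has_field_derivative_zero_constant) auto
  then have "D b = D a" using \<open>a \<le> b\<close> by auto
  then show ?thesis using ug by (simp add: D_def has_integral_iff)
qed

text \<open>Such a \<open>d\<close> is orthogonal to polynomials by parts, then to continuous
  functions by Stone-Weierstrass, then to \<open>sgn d\<close> by dominated convergence, so the
  integral of \<open>\<bar>d t\<bar>\<close> vanishes.\<close>

lemma ae_zero_of_integrals_zero:
  fixes d :: "real \<Rightarrow> real"
  assumes "a \<le> b" and d: "d absolutely_integrable_on {a..b}"
    and zero: "\<And>s t. a \<le> s \<Longrightarrow> s \<le> t \<Longrightarrow> t \<le> b \<Longrightarrow> (d has_integral 0) {s..t}"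
  shows "negligible {t. t \<in> {a..b} \<and> d t \<noteq> 0}"
proof -
  have prod: "(\<lambda>t. q t * d t) integrable_on {a..b}" if "continuous_on {a..b} q" for q :: "real \<Rightarrow> real"
    using that d by (intro set_lebesgue_integral_eq_integral(1) absolutely_integrable_bounded_measurable_product_real
        continuous_imp_measurable_on_sets_lebesgue compact_imp_bounded compact_continuous_image) auto
  have poly: "integral {a..b} (\<lambda>t. p t * d t) = 0" if pol: "real_polynomial_function p" for p
  proof -
    obtain p' where p': "real_polynomial_function p'" "\<And>x. (p has_real_derivative p' x) (at x)"
      using has_real_derivative_polynomial_function[OF pol] by blast
    have c: "continuous_on {a..b} p'"
      using p'(1) by (simp add: continuous_on_polymonial_function real_polynomial_function_eq)
    have "bounded (p' ` {a..b})"
      by (intro compact_imp_bounded compact_continuous_image c) auto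
    then obtain L where "\<forall>t\<in>{a..b}. \<bar>p' t\<bar> \<le> L" by (auto simp: bounded_iff)
    then have L: "\<And>t. t \<in> {a..b} \<Longrightarrow> \<bar>p' t\<bar> \<le> L" by blast
    have "(p' has_integral (p t - p s)) {s..t}" if "s \<le> t" for s t
      using p'(2) that by (intro fundamental_theorem_of_calculus)
        (auto simp flip: has_real_derivative_iff_has_vector_derivative intro: has_field_derivative_at_within)
    \<comment> \<open>The product rule with the zero function in the role of \<open>f\<close>: by
      \<open>zero\<close>, it is an indefinite integral of \<open>d\<close>.\<close>
    then have "((\<lambda>t. p t * d t) has_integral (p b * 0 - p a * 0 - integral {a..b} (\<lambda>t. p' t * 0))) {a..b}"
      using zero by (intro integral_product_rule[OF \<open>a \<le> b\<close> absolutely_integrable_continuous_real[OF c] d _ _ L]) auto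
    then show ?thesis by (simp add: has_integral_iff)
  qed
  have ad: "(\<lambda>t. \<bar>d t\<bar>) integrable_on {a..b}" using d by (simp add: absolutely_integrable_on_def)
  have cont: "integral {a..b} (\<lambda>t. q t * d t) = 0" if q: "continuous_on {a..b} q" for q :: "real \<Rightarrow> real"
  proof -
    define I where "I = integral {a..b} (\<lambda>t. \<bar>d t\<bar>)"
    have I: "0 \<le> I" by (simp add: I_def integral_nonneg ad)
    have "\<bar>integral {a..b} (\<lambda>t. q t * d t)\<bar> \<le> e" if "e > 0" for e
    proof -
      have "0 < e / (I + 1)" using that I by auto
      then obtain p where p: "real_polynomial_function p" "\<And>x. x \<in> {a..b} \<Longrightarrow> \<bar>q x - p x\<bar> < e / (I + 1)"
        using Stone_Weierstrass_real_polynomial_function[of "{a..b}" q "e / (I + 1)"] q by auto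
      have cp: "continuous_on {a..b} p"
        using p(1) by (simp add: continuous_on_polymonial_function real_polynomial_function_eq)
      have "integral {a..b} (\<lambda>t. q t * d t) = integral {a..b} (\<lambda>t. q t * d t) - integral {a..b} (\<lambda>t. p t * d t)"
        using poly[OF p(1)] by simp
      also have "\<dots> = integral {a..b} (\<lambda>t. (q t - p t) * d t)"
        using prod[OF q] prod[OF cp] by (simp add: left_diff_distrib integral_diff)
      also have "\<bar>\<dots>\<bar> \<le> integral {a..b} (\<lambda>t. e / (I + 1) * \<bar>d t\<bar>)"
        using p(2) prod[OF continuous_on_diff[OF q cp]] ad unfolding real_norm_def[symmetric]
        by (intro integral_norm_bound_integral integrable_on_mult_right)
          (auto simp only: norm_mult intro!: mult_right_mono[OF less_imp_le] norm_ge_zero)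
      also have "\<dots> = e * (I / (I + 1))" by (simp add: I_def)
      also have "\<dots> \<le> e * 1" using that I by (intro mult_left_mono) auto
      finally show ?thesis by simp
    qed
    then show ?thesis
      by (metis abs_le_zero_iff dense_ge)
  qed
  \<comment> \<open>Measurability of \<open>sgn d\<close> supplies continuous functions converging
    to it off a null set.\<close>
  have "(\<lambda>t. sgn (d t)) \<in> borel_measurable (lebesgue_on {a..b})"
    using d by (intro measurable_compose[OF _ borel_measurable_sgn]) (simp add: absolutely_integrable_measurable)
  then have "(\<lambda>t. sgn (d t)) measurable_on {a..b}"
    by (simp add: measurable_on_iff_borel_measurable)
  then obtain N g where N: "negligible N" and g: "\<And>n. continuous_on UNIV (g n)"
    and lim: "\<And>x. x \<notin> N \<Longrightarrow> (\<lambda>n. g n x) \<longlonglongrightarrow> (if x \<in> {a..b} then sgn (d x) else 0)"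
    unfolding measurable_on_def by blast
  \<comment> \<open>Clipping to \<open>[-1, 1]\<close> keeps the limit, since \<open>sgn\<close>
    takes its values there, and makes \<open>\<bar>d x\<bar>\<close> a dominating function.\<close>
  define h where "h n x = max (-1) (min 1 (g n x))" for n x
  have h: "continuous_on {a..b} (h n)" for n
    unfolding h_def by (intro continuous_intros continuous_on_subset[OF g]) auto
  have spike: "(f has_integral i) ({a..b} - N) \<longleftrightarrow> (f has_integral i) {a..b}" for f :: "real \<Rightarrow> real" and i
    by (rule has_integral_spike_set_eq) (auto intro: negligible_subset[OF N])
  have hl: "(\<lambda>n. h n x * d x) \<longlonglongrightarrow> \<bar>d x\<bar>" if "x \<in> {a..b} - N" for x
  proof -
    have "(\<lambda>n. h n x * d x) \<longlonglongrightarrow> max (-1) (min 1 (sgn (d x))) * d x"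
      unfolding h_def using lim[of x] that by (intro tendsto_intros) auto
    also have "max (-1) (min 1 (sgn (d x))) * d x = \<bar>d x\<bar>" by (auto simp: sgn_if)
    finally show ?thesis .
  qed
  have hd: "((\<lambda>x. h n x * d x) has_integral 0) {a..b}" for n
    using cont[OF h] prod[OF h] by (simp add: has_integral_iff)
  have "(\<lambda>n. integral ({a..b} - N) (\<lambda>x. h n x * d x)) \<longlonglongrightarrow> integral ({a..b} - N) (\<lambda>x. \<bar>d x\<bar>)"
  proof (rule dominated_convergence(2))
    show "(\<lambda>x. h n x * d x) integrable_on {a..b} - N" for n
      using hd[of n] spike by (auto simp: integrable_on_def)
    show "(\<lambda>x. \<bar>d x\<bar>) integrable_on {a..b} - N"
      using ad spike by (auto simp: integrable_on_def)
    show "norm (h n x * d x) \<le> \<bar>d x\<bar>" for n x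
    proof -
      have "\<bar>h n x\<bar> \<le> 1" by (auto simp: h_def)
      then show ?thesis by (simp add: abs_mult mult_left_le_one_le)
    qed
    show "\<And>x. x \<in> {a..b} - N \<Longrightarrow> (\<lambda>k. h k x * d x) \<longlonglongrightarrow> \<bar>d x\<bar>" by (rule hl)
  qed
  moreover have "integral ({a..b} - N) (\<lambda>x. h n x * d x) = 0" for n
    using hd[of n] spike by (simp add: integral_unique)
  ultimately have "integral ({a..b} - N) (\<lambda>x. \<bar>d x\<bar>) = 0"
    by (simp add: LIMSEQ_const_iff)
  moreover have "integral ({a..b} - N) (\<lambda>x. \<bar>d x\<bar>) = integral {a..b} (\<lambda>x. \<bar>d x\<bar>)"
    using spike ad by (metis has_integral_iff)
  ultimately have "((\<lambda>x. \<bar>d x\<bar>) has_integral 0) {a..b}"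
    using ad by (simp add: has_integral_iff)
  then have "integral {a..b} (\<lambda>x. \<bar>d x\<bar>) = 0" by (rule integral_unique)
  moreover have int: "integrable (lebesgue_on {a..b}) (\<lambda>x. \<bar>d x\<bar>)"
    using d by (simp add: absolutely_integrable_measurable_real)
  ultimately have "AE x in lebesgue_on {a..b}. \<bar>d x\<bar> = 0"
    using integral_nonneg_eq_0_iff_AE[OF int] lebesgue_integral_eq_integral[OF int] by simp
  then have "AE x in lebesgue. x \<in> {a..b} \<longrightarrow> d x = 0"
    by (simp add: AE_restrict_space_iff)
  then show ?thesis
    by (simp add: completion.AE_iff_null_sets negligible_iff_null_sets)
qed

section \<open>Periodic Bernoulli functions\<close>

text \<open>
  The sum of the terms of \<open>B\<^sub>n\<close> with indices \<open>\<beta> = k + 1\<close> and \<open>\<beta> = - (k + 1)\<close>; the factor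
  \<open>i\<^bsup>-n\<^esup>\<close> has become a phase shift of the cosine.
\<close>

definition bern_term :: "nat \<Rightarrow> nat \<Rightarrow> real \<Rightarrow> real" where
  "bern_term n k x = 2 * cos (2 * pi * (real k + 1) * x + real n * (pi / 2)) / (2 * pi * (real k + 1)) ^ n"

text \<open>
  For \<open>n = 1\<close> the series converges only conditionally and, at the integers, to 0 rather than to
  the value \<open>- 1 / 2\<close> chosen here.
\<close>

definition bern :: "nat \<Rightarrow> real \<Rightarrow> real" where
  "bern n x = (if n = 1 then frac x - 1 / 2 else \<Sum>k. bern_term n k x)"

lemma bern_term_deriv:
  "(bern_term (Suc n) k has_real_derivative - bern_term n k x) (at x)"
proof -
  define c where "c = 2 * pi * (real k + 1)"
  have c: "c > 0" by (auto simp: c_def intro!: mult_pos_pos)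
  have "((\<lambda>x. 2 * cos (c * x + (real n + 1) * (pi / 2)) / c ^ Suc n) has_real_derivative
      - (2 * sin (c * x + (real n + 1) * (pi / 2)) * c / c ^ Suc n)) (at x)"
    by (auto intro!: derivative_eq_intros)
  also have "2 * sin (c * x + (real n + 1) * (pi / 2)) * c / c ^ Suc n = bern_term n k x"
  proof -
    define y where "y = c * x + real n * (pi / 2)"
    have "c * x + (real n + 1) * (pi / 2) = y + pi / 2" by (simp add: y_def algebra_simps)
    then show ?thesis
      using c unfolding bern_term_def c_def[symmetric] y_def[symmetric] by (simp add: sin_add)
  qed
  finally show ?thesis unfolding bern_term_def[abs_def] c_def by (simp add: add_ac)
qed

lemma abs_bern_term_le:
  assumes "n \<ge> 2"
  shows "\<bar>bern_term n k x\<bar> \<le> 1 / (real k + 1) ^ 2"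
proof -
  define c where "c = 2 * pi * (real k + 1)"
  have pi: "1 \<le> pi" using pi_gt3 by simp
  have c: "2 * (real k + 1) \<le> c"
    unfolding c_def using pi by (intro mult_right_mono) auto
  have "2 * (real k + 1) ^ 2 \<le> (2 * (real k + 1)) ^ 2"
    unfolding power_mult_distrib by simp
  also have "\<dots> \<le> c ^ 2" using c by (intro power_mono) auto
  also have "\<dots> \<le> c ^ n" using c assms by (intro power_increasing) auto
  finally have cn: "2 * (real k + 1) ^ 2 \<le> c ^ n" .
  have "\<bar>bern_term n k x\<bar> = 2 * \<bar>cos (c * x + real n * (pi / 2))\<bar> / c ^ n"
    using c by (simp add: bern_term_def c_def abs_mult)
  also have "\<dots> \<le> 2 * 1 / (2 * (real k + 1) ^ 2)"
    using cn by (intro frac_le mult_left_mono) auto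
  finally show ?thesis by simp
qed

lemma summable_inverse_Suc_square: "summable (\<lambda>k. 1 / (real k + 1) ^ 2)"
  using inverse_squares_sums by (auto simp: sums_iff add_ac)

lemma uniform_limit_bern_term:
  assumes "n \<ge> 2"
  shows "uniform_limit UNIV (\<lambda>N x. \<Sum>k<N. bern_term n k x) (\<lambda>x. \<Sum>k. bern_term n k x) sequentially"
  using abs_bern_term_le[OF assms] by (intro Weierstrass_m_test[OF _ summable_inverse_Suc_square]) auto

lemma bern_term_sums:
  assumes "n \<ge> 2"
  shows "(\<lambda>k. bern_term n k x) sums bern n x"
proof -
  have "summable (\<lambda>k. bern_term n k x)"
    using abs_bern_term_le[OF assms] by (intro summable_comparison_test[OF _ summable_inverse_Suc_square]) auto
  then show ?thesis using assms by (simp add: bern_def summable_sums)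
qed

lemma continuous_on_bern:
  assumes "n \<ge> 2"
  shows "continuous_on S (bern n)"
proof -
  have "continuous_on UNIV (\<lambda>x. \<Sum>k. bern_term n k x)"
    unfolding bern_term_def
    by (rule uniform_limit_theorem[OF _ uniform_limit_bern_term[OF assms, unfolded bern_term_def]])
      (intro always_eventually allI continuous_intros | simp)+
  then show ?thesis
    using assms by (auto simp: bern_def[abs_def] intro: continuous_on_subset)
qed

text \<open>Termwise differentiation; the differentiated series still converges uniformly for
  \<open>n \<ge> 2\<close>. The step from order 2 to the sawtooth goes through the explicit form of
  \<open>bern 2\<close> instead.\<close>

lemma bern_deriv:
  assumes "n \<ge> 2"
  shows "(bern (Suc n) has_real_derivative - bern n x) (at x)"
proof -
  have "uniform_limit UNIV (\<lambda>N x. - (\<Sum>k<N. bern_term n k x)) (\<lambda>x. - (\<Sum>k. bern_term n k x)) sequentially"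
    by (rule uniform_limit_uminus[OF uniform_limit_bern_term[OF assms]])
  then have "uniformly_convergent_on UNIV (\<lambda>N x. \<Sum>k<N. - bern_term n k x)"
    by (auto simp: uniformly_convergent_on_def sum_negf)
  then have "((\<lambda>x. \<Sum>k. bern_term (Suc n) k x) has_real_derivative (\<Sum>k. - bern_term n k x)) (at x)"
    using sums_summable[OF bern_term_sums[of "Suc n" 0]] assms
    by (intro has_field_derivative_series'(2)[of UNIV, where ?x0.0 = 0] bern_term_deriv) auto
  also have "(\<Sum>k. - bern_term n k x) = - bern n x"
    using sums_minus[OF bern_term_sums[OF assms]] by (simp add: sums_iff)
  finally show ?thesis using assms by (simp add: bern_def[abs_def])
qed

section \<open>Closed form of \<open>bern 2\<close> on the unit interval\<close>

lemma dirichlet_kernel: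
  "sin (pi * x) * (1 + (\<Sum>k<n. bern_term 0 k x)) = sin ((2 * real n + 1) * pi * x)"
proof (induction n)
  case (Suc n)
  define A B where "A = pi * x" and "B = 2 * pi * (real n + 1) * x"
  \<comment> \<open>The summand \<open>bern_term 0 n x\<close> is \<open>2 * cos B\<close>, and
    \<open>2 * sin A * cos B = sin (B + A) - sin (B - A)\<close> makes the sum telescope.\<close>
  have "sin A * (1 + (\<Sum>k<Suc n. bern_term 0 k x)) = sin (B - A) + 2 * sin A * cos B"
    using Suc by (simp add: bern_term_def A_def B_def algebra_simps)
  also have "\<dots> = sin (B + A)" by (simp add: sin_add sin_diff)
  finally show ?case by (simp add: A_def B_def algebra_simps)
qed simp

text \<open>The second derivative of \<open>E\<close> is a Dirichlet kernel, which oscillates at a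
  frequency of order \<open>n\<close> and is bounded by \<open>1 / s\<close> on \<open>S\<close>.
  One integration gains a factor of order \<open>1 / n\<close>, the next preserves it.\<close>

lemma bern_2_error_bound:
  fixes n :: nat
  assumes "convex S" "1 / 2 \<in> S" and s: "0 < s" "\<And>t. t \<in> S \<Longrightarrow> s \<le> sin (pi * t)"
    and S: "S \<subseteq> {0..1}" and "x \<in> S"
  defines "E \<equiv> \<lambda>t::real. (\<Sum>k<n. bern_term 2 k t) + (t\<^sup>2 - t) / 2"
  shows "\<bar>E x - E (1 / 2)\<bar> \<le> 2 / s\<^sup>2 / (2 * real n + 1)"
proof -
  define N where "N = (2 * real n + 1) * pi"
  have N: "N > 0" by (simp add: N_def)
  have N': "1 / N \<le> 1 / (2 * real n + 1)"
    using pi_gt3 unfolding N_def by (intro frac_le) auto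
  have s1: "s \<le> 1" using s(2)[OF \<open>1/2 \<in> S\<close>] by simp
  then have s2: "1 / s \<le> 1 / s\<^sup>2"
    using s(1) by (intro frac_le) (auto simp: power2_eq_square mult_left_le)
  define E' where "E' t = t - 1 / 2 - (\<Sum>k<n. bern_term 1 k t)" for t
  have E: "(E has_real_derivative E' t) (at t within S)" for t
  proof -
    have "((\<lambda>t. \<Sum>k<n. bern_term (Suc 1) k t) has_real_derivative (\<Sum>k<n. - bern_term 1 k t)) (at t within S)"
      by (intro DERIV_sum has_field_derivative_at_within[OF bern_term_deriv])
    moreover have "((\<lambda>t. (t\<^sup>2 - t) / 2) has_real_derivative t - 1 / 2) (at t within S)"
      by (auto intro!: derivative_eq_intros)
    ultimately have "((\<lambda>t. (\<Sum>k<n. bern_term (Suc 1) k t) + (t\<^sup>2 - t) / 2) has_real_derivative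
        (\<Sum>k<n. - bern_term 1 k t) + (t - 1 / 2)) (at t within S)"
      by (rule DERIV_add)
    then show ?thesis
      unfolding E_def E'_def by (simp add: sum_negf numeral_2_eq_2)
  qed
  \<comment> \<open>\<open>E''\<close> is the Dirichlet kernel \<open>sin (N t) / sin (\<pi> t)\<close>; the correction term is its integral by
    parts, which leaves a derivative of order \<open>1 / N\<close>.\<close>
  define W where "W t = E' t + cos (N * t) / (N * sin (pi * t))" for t
  define W' where "W' t = - (cos (N * t) * cos (pi * t) * pi) / (N * (sin (pi * t))\<^sup>2)" for t
  have W: "(W has_real_derivative W' t) (at t within S)" if "t \<in> S" for t
  proof -
    have nz: "sin (pi * t) \<noteq> 0" using s(2)[OF that] s(1) by auto
    have "(E' has_real_derivative 1 + (\<Sum>k<n. bern_term 0 k t)) (at t within S)"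
    proof -
      have "((\<lambda>t. \<Sum>k<n. bern_term (Suc 0) k t) has_real_derivative (\<Sum>k<n. - bern_term 0 k t)) (at t within S)"
        by (intro DERIV_sum has_field_derivative_at_within[OF bern_term_deriv])
      moreover have "((\<lambda>t. t - 1 / 2) has_real_derivative 1) (at t within S)"
        by (auto intro!: derivative_eq_intros)
      ultimately have "((\<lambda>t. t - 1 / 2 - (\<Sum>k<n. bern_term (Suc 0) k t)) has_real_derivative
          1 - (\<Sum>k<n. - bern_term 0 k t)) (at t within S)"
        by (rule DERIV_diff[rotated])
      then show ?thesis
        unfolding E'_def by (simp add: sum_negf)
    qed
    also have "1 + (\<Sum>k<n. bern_term 0 k t) = sin (N * t) / sin (pi * t)"
      using dirichlet_kernel[of t n] nz by (simp add: N_def field_simps)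
    finally show ?thesis
      unfolding W_def W'_def using nz N
      by (auto intro!: derivative_eq_intros simp: field_simps power2_eq_square)
  qed
  have W'b: "norm (W' t) \<le> 1 / s\<^sup>2 / (2 * real n + 1)" if "t \<in> S" for t
  proof -
    have "\<bar>cos (N * t)\<bar> * \<bar>cos (pi * t)\<bar> \<le> 1 * 1" by (intro mult_mono) auto
    then have "norm (W' t) \<le> 1 * pi / (N * s\<^sup>2)"
      unfolding W'_def using N s that
      by (auto simp: abs_mult intro!: frac_le mult_mono power_mono)
    then show ?thesis by (simp add: N_def mult_ac)
  qed
  \<comment> \<open>\<open>1 / 2\<close> serves as base point because every term of
    \<open>E'\<close> and the correction \<open>cos (N * t)\<close> vanish there.\<close>
  have "bern_term 1 k (1 / 2) = 0" for k
  proof -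
    have "2 * pi * (real k + 1) * (1 / 2) + pi / 2 = of_int (2 * int (Suc k) + 1) * (pi / 2)"
      by (simp add: algebra_simps)
    then have "cos (2 * pi * (real k + 1) * (1 / 2) + pi / 2) = 0"
      unfolding cos_zero_iff_int by (intro exI[of _ "2 * int (Suc k) + 1"]) auto
    then show ?thesis unfolding bern_term_def by simp
  qed
  moreover have "cos (N * (1 / 2)) = 0"
    unfolding cos_zero_iff_int by (intro exI[of _ "2 * int n + 1"]) (auto simp: N_def)
  ultimately have W0: "W (1 / 2) = 0" by (simp add: W_def E'_def)
  have d1: "norm (t - 1 / 2) \<le> 1" if "t \<in> S" for t
  proof -
    have "t \<in> {0..1}" using that S by blast
    then show ?thesis by (simp add: abs_le_iff)
  qed
  have E'b: "norm (E' t) \<le> 2 / s\<^sup>2 / (2 * real n + 1)" if "t \<in> S" for t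
  proof -
    have "norm (W t - W (1 / 2)) \<le> 1 / s\<^sup>2 / (2 * real n + 1) * norm (t - 1 / 2)"
      using field_differentiable_bound[OF \<open>convex S\<close> W W'b that \<open>1 / 2 \<in> S\<close>] .
    also have "\<dots> \<le> 1 / s\<^sup>2 / (2 * real n + 1) * 1"
      using d1[OF that] by (intro mult_left_mono) auto
    finally have "\<bar>W t\<bar> \<le> 1 / s\<^sup>2 / (2 * real n + 1)" using W0 by simp
    moreover have "\<bar>cos (N * t) / (N * sin (pi * t))\<bar> \<le> 1 / (N * s)"
      using N s that by (auto simp: abs_mult intro!: frac_le mult_mono order.trans[OF s(2)[OF that] abs_ge_self])
    moreover have "1 / (N * s) \<le> 1 / s\<^sup>2 / (2 * real n + 1)"
      using mult_mono[OF N' s2] s(1) by (simp add: mult_ac)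
    ultimately have "\<bar>E' t\<bar> \<le> 1 / s\<^sup>2 / (2 * real n + 1) + 1 / s\<^sup>2 / (2 * real n + 1)"
      unfolding W_def by linarith
    then show ?thesis by simp
  qed
  have "norm (E x - E (1 / 2)) \<le> 2 / s\<^sup>2 / (2 * real n + 1) * norm (x - 1 / 2)"
    using field_differentiable_bound[OF \<open>convex S\<close> E E'b \<open>x \<in> S\<close> \<open>1 / 2 \<in> S\<close>] .
  also have "\<dots> \<le> 2 / s\<^sup>2 / (2 * real n + 1) * 1"
    using d1[OF \<open>x \<in> S\<close>] by (intro mult_left_mono) auto
  finally show ?thesis by simp
qed

text \<open>As the number of terms grows, the error bound makes \<open>q\<close> constant on the
  open interval. Continuity extends this to the endpoints, and the value at 0 identifies the
  constant.\<close>

lemma bern_2_quadratic: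
  assumes "x \<in> {0..1}"
  shows "bern 2 x = bern 2 0 - (x\<^sup>2 - x) / 2"
proof -
  define q where "q t = bern 2 t + (t\<^sup>2 - t) / 2" for t
  have q: "q x = q (1 / 2)" if "x \<in> {0<..<1}" for x
  proof -
    \<comment> \<open>The segment from \<open>x\<close> to \<open>1 / 2\<close> is compact inside
      \<open>{0<..<1}\<close>, so the minimum of \<open>sin (pi * t)\<close> on it is a positive
      choice for the \<open>s\<close> of the error bound.\<close>
    define S where "S = {min x (1/2)..max x (1/2)}"
    have S: "S \<noteq> {}" "compact S" "convex S" "1 / 2 \<in> S" "x \<in> S" "S \<subseteq> {0<..<1}"
      using that by (auto simp: S_def)
    have "\<exists>y\<in>S. \<forall>t\<in>S. sin (pi * y) \<le> sin (pi * t)"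
      by (intro continuous_attains_inf S continuous_intros)
    then obtain y where y: "y \<in> S" "\<And>t. t \<in> S \<Longrightarrow> sin (pi * y) \<le> sin (pi * t)" by blast
    have "y \<in> {0<..<1}" using y(1) S(6) by blast
    then have sy: "0 < sin (pi * y)" by (intro sin_gt_zero) auto
    define E where "E n t = (\<Sum>k<n. bern_term 2 k t) + (t\<^sup>2 - t) / 2" for n t
    have lim: "(\<lambda>n. E n t) \<longlonglongrightarrow> q t" for t
      using bern_term_sums[of 2 t] unfolding E_def q_def sums_def by (intro tendsto_intros) auto
    have "(\<lambda>n. E n x - E n (1 / 2)) \<longlonglongrightarrow> 0"
    proof (rule Lim_null_comparison)
      show "\<forall>\<^sub>F n in sequentially. norm (E n x - E n (1 / 2)) \<le> 2 / (sin (pi * y))\<^sup>2 / (2 * real n + 1)"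
        using bern_2_error_bound[OF S(3,4) sy y(2) _ S(5)] S(6) by (fastforce simp: E_def)
      show "(\<lambda>n. 2 / (sin (pi * y))\<^sup>2 / (2 * real n + 1)) \<longlonglongrightarrow> 0"
        by real_asymp
    qed
    moreover have "(\<lambda>n. E n x - E n (1 / 2)) \<longlonglongrightarrow> q x - q (1 / 2)"
      by (intro tendsto_diff lim)
    ultimately have "q x - q (1 / 2) = 0" using LIMSEQ_unique by blast
    then show ?thesis by simp
  qed
  have "continuous_on (closure {0<..<1::real}) q"
    unfolding q_def by (intro continuous_intros continuous_on_bern) auto
  then have "q t = q (1 / 2)" if "t \<in> {0..1}" for t
    by (rule continuous_constant_on_closure[OF _ q]) (use that in auto)
  from this[of x] this[of 0] assms show ?thesis by (simp add: q_def)
qed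

section \<open>Periodicity and summable derivatives of the Bernoulli functions\<close>

lemma bern_term_periodic: "bern_term n k (x + 1) = bern_term n k x"
proof -
  have "2 * pi * (real k + 1) * (x + 1) + real n * (pi / 2)
      = (2 * pi * (real k + 1) * x + real n * (pi / 2)) + 2 * pi * of_int (int (Suc k))"
    by (simp add: algebra_simps)
  then have "cos (2 * pi * (real k + 1) * (x + 1) + real n * (pi / 2))
      = cos (2 * pi * (real k + 1) * x + real n * (pi / 2))"
    by (simp only: cos_add[of "_ + _" "2 * pi * of_int _"] cos_int_2pin sin_int_2pin)
  then show ?thesis unfolding bern_term_def by simp
qed

lemma bern_periodic: "bern n (x + 1) = bern n x"
  by (simp add: bern_def bern_term_periodic frac_def)

lemma bern_frac: "bern n (frac x) = bern n x"
proof -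
  have nat: "bern n (y + of_nat j) = bern n y" for y j
  proof (induction j)
    case (Suc j)
    then show ?case using bern_periodic[of n "y + real j"] by (simp add: add_ac)
  qed simp
  have "bern n (y + of_int i) = bern n y" for y i
    using nat[of y "nat i"] nat[of "y + of_int i" "nat (- i)"] by (cases "i \<ge> 0") auto
  from this[of "frac x" "\<lfloor>x\<rfloor>"] show ?thesis by (simp add: frac_def)
qed

text \<open>For \<open>n \<ge> 2\<close> the derivative is classical. For \<open>n = 1\<close> the
  parabolic pieces of \<open>bern 2\<close> are differentiated between the integers; only finitely
  many integers lie in \<open>{a..b}\<close>, and the fundamental theorem tolerates them.\<close>

lemma loc_summable_deriv_bern:
  assumes "n \<ge> 1"
  shows "loc_summable_deriv (bern (Suc n)) (\<lambda>t. - bern n t)"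
  unfolding loc_summable_deriv_def
proof (intro allI impI conjI)
  fix a b :: real assume ab: "a \<le> b"
  show int: "((\<lambda>t. - bern n t) has_integral bern (Suc n) b - bern (Suc n) a) {a..b}"
  proof (cases "n = 1")
    case True
    have "finite (\<int> \<inter> {a..b})"
    proof (rule finite_subset)
      show "\<int> \<inter> {a..b} \<subseteq> of_int ` {\<lfloor>a\<rfloor>..\<lceil>b\<rceil>}"
        by (auto elim!: Ints_cases simp: image_iff floor_le_iff le_ceiling_iff)
    qed simp
    moreover have "(bern (Suc n) has_vector_derivative - bern n x) (at x)"
      if x: "x \<in> {a<..<b} - \<int> \<inter> {a..b}" for x
    proof -
      have "x \<noteq> of_int \<lfloor>x\<rfloor>"
        using x by (metis Diff_iff Int_iff Ints_of_int greaterThanLessThan_iff atLeastAtMost_iff less_imp_le)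
      then have "of_int \<lfloor>x\<rfloor> < x" using of_int_floor_le[of x] by linarith
      then have xi: "x \<in> {of_int \<lfloor>x\<rfloor><..<of_int \<lfloor>x\<rfloor> + 1}"
        using floor_correct[of x] by simp
      define g where "g y = bern 2 0 - ((y - of_int \<lfloor>x\<rfloor>)\<^sup>2 - (y - of_int \<lfloor>x\<rfloor>)) / 2" for y :: real
      have "(g has_real_derivative - bern 1 x) (at x)"
        unfolding g_def bern_def frac_def
        by (auto intro!: derivative_eq_intros simp: field_simps)
      then have "(bern 2 has_real_derivative - bern 1 x) (at x)"
      proof (rule has_field_derivative_transform_within_open[OF _ _ xi])
        fix y assume y: "y \<in> {of_int \<lfloor>x\<rfloor><..<of_int \<lfloor>x\<rfloor> + 1 :: real}"
        then have "frac y = y - of_int \<lfloor>x\<rfloor>" by (simp add: frac_unique_iff)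
        then show "g y = bern 2 y"
          using bern_2_quadratic[of "y - of_int \<lfloor>x\<rfloor>"] bern_frac[of 2 y] y by (simp add: g_def)
      qed simp
      then show ?thesis using True
        by (simp add: has_real_derivative_iff_has_vector_derivative numeral_2_eq_2)
    qed
    ultimately show ?thesis
      using assms by (intro fundamental_theorem_of_calculus_interior_strong[OF _ ab] continuous_on_bern) auto
  next
    case False
    then show ?thesis using assms
      by (intro fundamental_theorem_of_calculus[OF ab])
        (auto intro!: has_vector_derivative_at_within[OF bern_deriv[unfolded has_real_derivative_iff_has_vector_derivative]])
  qed
  show "(\<lambda>t. - bern n t) absolutely_integrable_on {a..b}"
  proof (cases "n = 1")
    case True
    show ?thesis
    proof (rule absolutely_integrable_integrable_bound)
      show "norm (- bern n t) \<le> 1" for t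
        using frac_ge_0[of t] frac_lt_1[of t] True by (simp only: bern_def refl if_True real_norm_def)
    qed (use int in auto)
  next
    case False
    then show ?thesis using assms
      by (intro absolutely_integrable_continuous_real continuous_intros continuous_on_bern) auto
  qed
qed

lemma bern_bounded:
  assumes "n \<ge> 1"
  shows "\<exists>L. \<forall>x. \<bar>bern n x\<bar> \<le> L"
proof (cases "n = 1")
  case True
  then have "\<bar>bern n x\<bar> \<le> 1" for x
    using frac_ge_0[of x] frac_lt_1[of x] by (simp only: bern_def refl if_True)
  then show ?thesis by blast
next
  case False
  then have n: "n \<ge> 2" using assms by auto
  have "bounded (bern n ` {0..1})"
    by (intro compact_imp_bounded compact_continuous_image continuous_on_bern n) auto
  then obtain L where L: "\<forall>x\<in>{0..1}. \<bar>bern n x\<bar> \<le> L" unfolding bounded_iff by auto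
  have "\<bar>bern n x\<bar> \<le> L" for x
    using bspec[OF L, of "frac x"] frac_ge_0[of x] frac_lt_1[of x] by (simp add: bern_frac)
  then show ?thesis by blast
qed

section \<open>Integration against periodic Bernoulli functions\<close>

lemma bern_term_even:
  "bern_term (2 * m) k x = (-1) ^ m * (2 * cos (2 * pi * (real k + 1) * x) / (2 * pi * (real k + 1)) ^ (2 * m))"
  by (simp add: bern_term_def cos_add)

lemma bern_even_uminus: "bern (2 * m) (- x) = bern (2 * m) x"
proof -
  have "bern_term (2 * m) k (- x) = bern_term (2 * m) k x" for k
    by (simp add: bern_term_even)
  then show ?thesis by (simp add: bern_def)
qed

text \<open>The exponent \<open>2 * m\<close> is even, so opposite indices share a real denominator
  and their terms add up to a real cosine. Absolute summability identifies the unordered sum with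
  two ordinary series.\<close>

lemma periodic_B_eq_bern:
  assumes "m \<ge> 1"
  shows "periodic_B (2 * m) x = of_real (bern (2 * m) x)"
proof -
  define t where "t \<beta> = exp (- 2 * of_real pi * \<i> * of_int \<beta> * of_real x) / (2 * of_real pi * \<i> * of_int \<beta>) ^ (2 * m)"
    for \<beta> :: int
  have t: "t \<beta> = cis (- (2 * pi * of_int \<beta> * x)) / of_real ((-1) ^ m * (2 * pi * of_int \<beta>) ^ (2 * m))" for \<beta>
  proof -
    have "(2 * of_real pi * \<i> * of_int \<beta> :: complex)\<^sup>2 = of_real (- ((2 * pi * of_int \<beta>)\<^sup>2))"
      by (simp add: power_mult_distrib)
    then have "(2 * of_real pi * \<i> * of_int \<beta> :: complex) ^ (2 * m) = of_real ((- ((2 * pi * of_int \<beta>)\<^sup>2)) ^ m)"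
      by (simp only: power_mult of_real_power)
    also have "(- ((2 * pi * of_int \<beta>)\<^sup>2)) ^ m = (-1) ^ m * (2 * pi * of_int \<beta>) ^ (2 * m)"
      by (metis power_minus power_mult)
    finally show ?thesis by (simp add: t_def cis_conv_exp mult_ac)
  qed
  \<comment> \<open>The index \<open>k\<close> starts at 0 and stands for the frequencies
    \<open>k + 1\<close> and \<open>- (k + 1)\<close>.\<close>
  define P N where "P k = t (int (Suc k))" and "N k = t (- int (Suc k))" for k
  have PN: "P k + N k = of_real (bern_term (2 * m) k x)" for k
  proof -
    define \<theta> q where "\<theta> = 2 * pi * (real k + 1) * x" and "q = (-1) ^ m * (2 * pi * (real k + 1)) ^ (2 * m)"
    have "P k = cis (- \<theta>) / of_real q"
      unfolding P_def t \<theta>_def q_def by (simp add: add_ac)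
    moreover have "N k = cis \<theta> / of_real q"
    proof -
      have A: "2 * pi * of_int (- int (Suc k)) = - (2 * pi * (real k + 1))"
        by (simp add: algebra_simps)
      show ?thesis unfolding N_def t \<theta>_def q_def A by simp
    qed
    moreover have "cis (- \<theta>) + cis \<theta> = of_real (2 * cos \<theta>)"
      by (simp add: complex_eq_iff)
    ultimately have "P k + N k = of_real (2 * cos \<theta> / q)"
      by (metis add_divide_distrib of_real_divide)
    also have "2 * cos \<theta> / q = bern_term (2 * m) k x"
      by (cases "even m") (simp_all add: bern_term_even \<theta>_def q_def)
    finally show ?thesis .
  qed
  have nt: "norm (t \<beta>) \<le> 1 / (real k + 1)\<^sup>2" if "\<bar>\<beta>\<bar> = int (Suc k)" for k \<beta>
  proof -
    have pi: "1 \<le> 2 * pi" using pi_gt3 by simp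
    have "\<bar>real_of_int \<beta>\<bar> = real k + 1" using that by (metis of_int_abs of_int_of_nat_eq of_nat_Suc add.commute)
    then have "norm (t \<beta>) = 1 / (2 * pi * (real k + 1)) ^ (2 * m)"
      unfolding t by (simp add: norm_divide norm_mult norm_power power_mult_distrib abs_mult)
    also have "\<dots> \<le> 1 / (real k + 1) ^ 2"
    proof (intro frac_le order.trans[OF _ power_increasing[of 2 "2 * m"]] power_mono)
      have "1 * (real k + 1) \<le> 2 * pi * (real k + 1)" by (rule mult_right_mono[OF pi]) simp
      then show le: "real k + 1 \<le> 2 * pi * (real k + 1)" by (simp only: mult_1)
      show "1 \<le> 2 * pi * (real k + 1)" by (rule order.trans[OF _ le]) simp
    qed (use assms in auto)
    finally show ?thesis .
  qed
  have sP: "summable (\<lambda>k. norm (P k))" and sN: "summable (\<lambda>k. norm (N k))"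
    using nt by (auto simp: P_def N_def intro!: summable_comparison_test[OF _ summable_inverse_Suc_square])
  note cP = summable_norm_cancel[OF sP] and cN = summable_norm_cancel[OF sN]
  have "(t has_sum suminf P) (range (\<lambda>k. int (Suc k)))"
    using norm_summable_imp_has_sum[OF sP summable_sums[OF cP]]
    by (subst has_sum_reindex) (simp_all add: inj_def P_def[abs_def] o_def)
  moreover have "(t has_sum suminf N) (range (\<lambda>k. - int (Suc k)))"
    using norm_summable_imp_has_sum[OF sN summable_sums[OF cN]]
    by (subst has_sum_reindex) (simp_all add: inj_def N_def[abs_def] o_def)
  ultimately have "(t has_sum (suminf P + suminf N)) (range (\<lambda>k. int (Suc k)) \<union> range (\<lambda>k. - int (Suc k)))"
    by (rule has_sum_Un_disjoint) auto
  also have "range (\<lambda>k. int (Suc k)) \<union> range (\<lambda>k. - int (Suc k)) = {\<beta>. \<beta> \<noteq> 0}"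
  proof -
    have "\<beta> \<in> range (\<lambda>k. int (Suc k)) \<union> range (\<lambda>k. - int (Suc k))" if "\<beta> \<noteq> 0" for \<beta>
    proof (cases "\<beta> > 0")
      case True
      then have "\<beta> = int (Suc (nat (\<beta> - 1)))" by simp
      then show ?thesis by blast
    next
      case False
      then have "\<beta> = - int (Suc (nat (- \<beta> - 1)))" using that by simp
      then show ?thesis by blast
    qed
    then show ?thesis by auto
  qed
  finally have "periodic_B (2 * m) x = suminf P + suminf N"
    unfolding periodic_B_def t_def by (rule infsumI)
  also have "\<dots> = (\<Sum>k. of_real (bern_term (2 * m) k x))"
    using suminf_add[OF cP cN] by (simp add: PN)
  also have "\<dots> = of_real (bern (2 * m) x)"
    using sums_of_real[OF bern_term_sums[of "2 * m" x], where 'a = complex] assms by (simp add: sums_iff)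
  finally show ?thesis .
qed

section \<open>Calculus of locally summable derivatives\<close>

lemma loc_summable_deriv_continuous:
  assumes "loc_summable_deriv f g"
  shows "continuous_on {a..b} f"
proof -
  have "f t = f a + integral {a..t} g" if "t \<in> {a..b}" for t
  proof -
    have "(g has_integral f t - f a) {a..t}"
      using assms that by (simp add: loc_summable_deriv_def)
    then show ?thesis by (simp add: integral_unique)
  qed
  moreover have "continuous_on {a..b} (\<lambda>t. f a + integral {a..t} g)"
  proof (cases "a \<le> b")
    case True
    then have "g integrable_on {a..b}"
      using assms by (auto simp: loc_summable_deriv_def)
    then show ?thesis by (intro continuous_intros indefinite_integral_continuous_1)
  qed simp
  ultimately show ?thesis by (subst continuous_on_cong[OF refl])
qed

text \<open>Used for derivatives below the top order: these are themselves indefinite integrals,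
  hence continuous, so they are classical derivatives.\<close>

lemma loc_summable_deriv_imp_deriv:
  assumes "loc_summable_deriv f g" and g: "\<And>a b. continuous_on {a..b} g"
  shows "(f has_real_derivative g t) (at t)"
proof -
  have eq: "f (t - 1) + integral {t - 1..s} g = f s" if "s \<in> {t - 1..t + 1}" for s
  proof -
    have "(g has_integral f s - f (t - 1)) {t - 1..s}"
      using assms(1) that by (simp add: loc_summable_deriv_def)
    then show ?thesis by (simp add: integral_unique)
  qed
  have "((\<lambda>s. f (t - 1) + integral {t - 1..s} g) has_real_derivative g t) (at t within {t - 1..t + 1})"
    using integral_has_real_derivative[OF g, of t "t - 1" "t + 1"] DERIV_add[OF DERIV_const] by fastforce
  then have "(f has_real_derivative g t) (at t within {t - 1..t + 1})"
    by (rule has_field_derivative_transform_within[where d = 1]) (use eq in auto)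
  then show ?thesis by (simp add: at_within_Icc_at)
qed

lemma loc_summable_deriv_shift:
  assumes "loc_summable_deriv f g"
  shows "loc_summable_deriv (\<lambda>t. f (t - y)) (\<lambda>t. g (t - y))"
proof -
  have shift: "((\<lambda>t. h (t - y)) has_integral i) {a..b}" if "(h has_integral i) {a - y..b - y}" for h :: "real \<Rightarrow> real" and a b i
    using has_integral_shift_Icc_real[of h "- y" i a b] that by (simp add: o_def)
  show ?thesis
    unfolding loc_summable_deriv_def
  proof (intro allI impI conjI)
    fix a b :: real assume ab: "a \<le> b"
    have g: "g absolutely_integrable_on {a - y..b - y}" "(g has_integral f (b - y) - f (a - y)) {a - y..b - y}"
      using assms ab by (auto simp: loc_summable_deriv_def)
    show "((\<lambda>t. g (t - y)) has_integral f (b - y) - f (a - y)) {a..b}"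
      by (rule shift[OF g(2)])
    then show "(\<lambda>t. g (t - y)) absolutely_integrable_on {a..b}"
      using shift[of "\<lambda>t. norm (g t)"] g(1) unfolding absolutely_integrable_on_def integrable_on_def by blast
  qed
qed

text \<open>The further derivative \<open>g\<close> makes \<open>h\<close> continuous, hence
  determined pointwise; a derivative of top order is determined, and so periodic, only almost
  everywhere.\<close>

lemma has_nth_deriv_periodic:
  assumes "has_nth_deriv n \<phi> h" "\<And>t. \<phi> (t + 1) = \<phi> t" "loc_summable_deriv h g"
  shows "h (t + 1) = h t"
  using assms(1,3)
proof (induction n arbitrary: h g t)
  case 0
  then show ?case using assms(2) by simp
next
  case (Suc n)
  then obtain k where k: "has_nth_deriv n \<phi> k" "loc_summable_deriv k h" by auto
  have D: "(k has_real_derivative h t) (at t)" for t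
    by (rule loc_summable_deriv_imp_deriv[OF k(2) loc_summable_deriv_continuous[OF Suc.prems(2)]])
  have "((\<lambda>s. k (s + 1)) has_real_derivative h (t + 1)) (at t)"
    using D[of "t + 1"] by (simp add: DERIV_shift)
  then show ?case
    using Suc.IH[OF k] DERIV_unique[OF D[of t]] by simp
qed

text \<open>The value \<open>\<phi> y\<close> comes from the jump of the sawtooth at
  \<open>t = y\<close>. Higher orders reduce to it by parts: boundary terms cancel by periodicity,
  and the minus sign of \<open>- bern (Suc n)\<close> cancels that of the formula.\<close>

lemma integral_bern_mult_deriv:
  assumes "has_nth_deriv (Suc n) \<phi> h" and per: "\<And>t. \<phi> (t + 1) = \<phi> t" and y: "y \<in> {0..1}"
  shows "((\<lambda>t. bern (Suc n) (t - y) * h t) has_integral (\<phi> y - integral {0..1} \<phi>)) {0..1}"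
  using assms(1)
proof (induction n arbitrary: h)
  case 0
  then have \<phi>: "loc_summable_deriv \<phi> h" by simp
  \<comment> \<open>\<open>c = 1 / 2\<close> gives the branch of the sawtooth left of
    \<open>y\<close>, \<open>c = - 1 / 2\<close> the one to the right; each differs from
    \<open>bern 1 (t - y)\<close> at most at the right end of its interval.\<close>
  have piece: "((\<lambda>t. (t - y + c) * h t) has_integral
      (b - y + c) * \<phi> b - (a - y + c) * \<phi> a - integral {a..b} \<phi>) {a..b}" if "a \<le> b" for a b c
  proof -
    have "((\<lambda>t. 1) has_integral ((t - y + c) - (s - y + c))) {s..t}" if "s \<le> t" for s t :: real
      using has_integral_const_real[of "1::real" s t] that by simp
    then have "((\<lambda>t. (t - y + c) * h t) has_integral
        (b - y + c) * \<phi> b - (a - y + c) * \<phi> a - integral {a..b} (\<lambda>t. 1 * \<phi> t)) {a..b}"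
      using \<phi> that by (intro integral_product_rule[where L = 1])
        (auto simp: loc_summable_deriv_def)
    then show ?thesis by simp
  qed
  have "((\<lambda>t. bern 1 (t - y) * h t) has_integral
      (y - y + 1 / 2) * \<phi> y - (0 - y + 1 / 2) * \<phi> 0 - integral {0..y} \<phi>) {0..y}"
  proof (rule has_integral_spike_finite[OF _ _ piece])
    fix t assume "t \<in> {0..y} - {y}"
    then have "\<lfloor>t - y\<rfloor> = -1" using y by (auto simp: floor_eq_iff)
    then show "bern 1 (t - y) * h t = (t - y + 1 / 2) * h t" by (simp add: bern_def frac_def)
  qed (use y in auto)
  moreover have "((\<lambda>t. bern 1 (t - y) * h t) has_integral
      (1 - y + - 1 / 2) * \<phi> 1 - (y - y + - 1 / 2) * \<phi> y - integral {y..1} \<phi>) {y..1}"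
  proof (rule has_integral_spike_finite[OF _ _ piece])
    fix t assume "t \<in> {y..1} - {1}"
    then have "\<lfloor>t - y\<rfloor> = 0" using y by (auto simp: floor_eq_iff)
    then show "bern 1 (t - y) * h t = (t - y + - 1 / 2) * h t" by (simp add: bern_def frac_def)
  qed (use y in auto)
  ultimately have "((\<lambda>t. bern 1 (t - y) * h t) has_integral
      ((y - y + 1 / 2) * \<phi> y - (0 - y + 1 / 2) * \<phi> 0 - integral {0..y} \<phi>) +
      ((1 - y + - 1 / 2) * \<phi> 1 - (y - y + - 1 / 2) * \<phi> y - integral {y..1} \<phi>)) {0..1}"
    using y by (intro has_integral_combine) auto
  moreover have "integral {0..y} \<phi> + integral {y..1} \<phi> = integral {0..1} \<phi>"
    using y by (intro Henstock_Kurzweil_Integration.integral_combine integrable_continuous_real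
        loc_summable_deriv_continuous[OF \<phi>]) auto
  ultimately show ?case using per[of 0] by (simp add: algebra_simps)
next
  case (Suc n)
  then obtain k where k: "has_nth_deriv (Suc n) \<phi> k" "loc_summable_deriv k h" by auto
  note IH = Suc.IH[OF k(1)]
  have u: "loc_summable_deriv (\<lambda>t. bern (Suc (Suc n)) (t - y)) (\<lambda>t. - bern (Suc n) (t - y))"
    by (rule loc_summable_deriv_shift[OF loc_summable_deriv_bern]) simp
  obtain L where L: "\<And>x. \<bar>- bern (Suc n) (x - y)\<bar> \<le> L"
    using bern_bounded[of "Suc n"] by auto
  have "((\<lambda>t. bern (Suc (Suc n)) (t - y) * h t) has_integral
      bern (Suc (Suc n)) (1 - y) * k 1 - bern (Suc (Suc n)) (0 - y) * k 0
        - integral {0..1} (\<lambda>t. - bern (Suc n) (t - y) * k t)) {0..1}"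
    using u k(2) by (intro integral_product_rule[OF _ _ _ _ _ L]) (auto simp: loc_summable_deriv_def)
  moreover have "k 1 = k 0" using has_nth_deriv_periodic[OF k(1) per k(2), of 0] by simp
  moreover have "bern (Suc (Suc n)) (1 - y) = bern (Suc (Suc n)) (0 - y)"
    using bern_periodic[of "Suc (Suc n)" "- y"] by (simp add: add.commute)
  ultimately show ?case using IH by (simp add: has_integral_iff)
qed

section \<open>The interpolation system\<close>

lemma loc_summable_deriv_add:
  "loc_summable_deriv f g \<Longrightarrow> loc_summable_deriv f' g' \<Longrightarrow> loc_summable_deriv (\<lambda>t. f t + f' t) (\<lambda>t. g t + g' t)"
  unfolding loc_summable_deriv_def by (simp add: set_integral_add(1) has_integral_add add_diff_add)

lemma loc_summable_deriv_mult:
  "loc_summable_deriv f g \<Longrightarrow> loc_summable_deriv (\<lambda>t. c * f t) (\<lambda>t. c * g t)"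
  unfolding loc_summable_deriv_def
  by (auto intro!: has_integral_mult_right simp flip: right_diff_distrib)

lemma has_nth_deriv_add:
  "has_nth_deriv n f g \<Longrightarrow> has_nth_deriv n f' g' \<Longrightarrow> has_nth_deriv n (\<lambda>t. f t + f' t) (\<lambda>t. g t + g' t)"
  by (induction n arbitrary: g g') (simp, metis has_nth_deriv.simps(2) loc_summable_deriv_add)

lemma has_nth_deriv_mult:
  "has_nth_deriv n f g \<Longrightarrow> has_nth_deriv n (\<lambda>t. c * f t) (\<lambda>t. c * g t)"
  by (induction n arbitrary: g) (simp, metis has_nth_deriv.simps(2) loc_summable_deriv_mult)

lemma has_nth_deriv_sum:
  assumes "finite A" "\<And>k. k \<in> A \<Longrightarrow> has_nth_deriv n (f k) (g k)"
  shows "has_nth_deriv n (\<lambda>t. \<Sum>k\<in>A. f k t) (\<lambda>t. \<Sum>k\<in>A. g k t)"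
  using assms
proof (induction A rule: finite_induct)
  case empty
  have "loc_summable_deriv (\<lambda>t. 0) (\<lambda>t. 0)" by (simp add: loc_summable_deriv_def)
  then have "has_nth_deriv n (\<lambda>t. 0) (\<lambda>t. 0)" by (induction n) auto
  then show ?case by simp
next
  case (insert k A)
  then show ?case using has_nth_deriv_add[of n "f k" "g k"] by simp
qed

lemma has_nth_deriv_bern:
  "j < n \<Longrightarrow> has_nth_deriv j (\<lambda>t. bern n (t - y)) (\<lambda>t. (-1) ^ j * bern (n - j) (t - y))"
proof (induction j)
  case (Suc j)
  have "loc_summable_deriv (\<lambda>t. bern (Suc (n - Suc j)) (t - y)) (\<lambda>t. - bern (n - Suc j) (t - y))"
    using Suc.prems by (intro loc_summable_deriv_shift[OF loc_summable_deriv_bern]) auto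
  then have "loc_summable_deriv (\<lambda>t. (-1) ^ j * bern (n - j) (t - y)) (\<lambda>t. (-1) ^ j * - bern (n - Suc j) (t - y))"
    using Suc.prems by (intro loc_summable_deriv_mult) (simp add: Suc_diff_Suc)
  then show ?case using Suc by auto
qed simp

text \<open>One further summable derivative makes \<open>h\<close> and \<open>h'\<close> continuous,
  which leaves no freedom on null sets.\<close>

lemma has_nth_deriv_unique:
  assumes "has_nth_deriv n \<phi> h" "has_nth_deriv n \<phi> h'" "loc_summable_deriv h g" "loc_summable_deriv h' g'"
  shows "h = h'"
  using assms
proof (induction n arbitrary: h h' g g')
  case (Suc n)
  obtain k where k: "has_nth_deriv n \<phi> k" "loc_summable_deriv k h" using Suc.prems(1) by auto
  obtain k' where k': "has_nth_deriv n \<phi> k'" "loc_summable_deriv k' h'" using Suc.prems(2) by auto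
  have "k = k'" by (rule Suc.IH[OF k(1) k'(1) k(2) k'(2)])
  moreover have "(k has_real_derivative h t) (at t)" "(k' has_real_derivative h' t) (at t)" for t
    using loc_summable_deriv_imp_deriv k(2) k'(2) loc_summable_deriv_continuous Suc.prems(3,4) by blast+
  ultimately show ?case using DERIV_unique by blast
qed simp

text \<open>Makes the choice in \<open>nth_deriv\<close> harmless: both top derivatives integrate to
  the same function \<open>h\<close>, so their difference has integral 0 over every
  interval.\<close>

lemma has_nth_deriv_ae_unique:
  assumes "m \<ge> 1" "has_nth_deriv m \<phi> g" "has_nth_deriv m \<phi> g'"
  shows "negligible {t. t \<in> {a..b} \<and> g t \<noteq> g' t}"
proof (cases "a \<le> b")
  case True
  obtain n where m: "m = Suc n" using assms(1) by (cases m) auto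
  obtain h h' where h: "has_nth_deriv n \<phi> h" "loc_summable_deriv h g"
    and h': "has_nth_deriv n \<phi> h'" "loc_summable_deriv h' g'"
    using assms(2,3) m by auto
  have "h = h'" by (rule has_nth_deriv_unique[OF h(1) h'(1) h(2) h'(2)])
  then have "((\<lambda>t. g t - g' t) has_integral 0) {s..t}" if "s \<le> t" for s t
    using h(2) h'(2) has_integral_diff[of g "h t - h s" "{s..t}" g' "h t - h s"] that
    by (simp add: loc_summable_deriv_def)
  moreover have "(\<lambda>t. g t - g' t) absolutely_integrable_on {a..b}"
    using h(2) h'(2) True by (intro set_integral_diff(1)) (auto simp: loc_summable_deriv_def)
  ultimately have "negligible {t. t \<in> {a..b} \<and> g t - g' t \<noteq> 0}"
    using True by (intro ae_zero_of_integrals_zero) auto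
  then show ?thesis by simp
qed simp

lemma has_nth_deriv_nth_deriv: "has_nth_deriv m \<phi> g \<Longrightarrow> has_nth_deriv m \<phi> (nth_deriv m \<phi>)"
  unfolding nth_deriv_def by (rule someI[of "has_nth_deriv m \<phi>"])

lemma has_integral_nth_deriv_square:
  assumes "m \<ge> 1" "has_nth_deriv m \<phi> g"
  shows "((\<lambda>t. (nth_deriv m \<phi> t)\<^sup>2) has_integral i) {0..1} \<longleftrightarrow> ((\<lambda>t. (g t)\<^sup>2) has_integral i) {0..1}"
  by (rule has_integral_spike_eq[OF has_nth_deriv_ae_unique[OF assms(1) has_nth_deriv_nth_deriv[OF assms(2)] assms(2)]])
    auto

text \<open>As \<open>g\<close> has norm 1, \<open>L * g\<close> is the projection of
  \<open>f\<close> onto \<open>g\<close>, and \<open>Q - L\<^sup>2\<close> is the squared norm of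
  the remainder.\<close>

lemma has_integral_Cauchy_Schwarz_unit:
  fixes f g :: "real \<Rightarrow> real"
  assumes "((\<lambda>t. (f t)\<^sup>2) has_integral Q) S" "((\<lambda>t. (g t)\<^sup>2) has_integral 1) S"
    "((\<lambda>t. f t * g t) has_integral L) S"
  shows "L\<^sup>2 \<le> Q"
proof -
  have "((\<lambda>t. (f t)\<^sup>2 - 2 * L * (f t * g t) + L\<^sup>2 * (g t)\<^sup>2) has_integral (Q - 2 * L * L + L\<^sup>2 * 1)) S"
    by (intro has_integral_add has_integral_diff has_integral_mult_right assms)
  moreover have "(f t)\<^sup>2 - 2 * L * (f t * g t) + L\<^sup>2 * (g t)\<^sup>2 = (f t - L * g t)\<^sup>2" for t
    by (simp add: power2_eq_square algebra_simps)
  ultimately have "((\<lambda>t. (f t - L * g t)\<^sup>2) has_integral (Q - L\<^sup>2)) S"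
    by (simp add: power2_eq_square)
  then have "0 \<le> Q - L\<^sup>2" by (rule has_integral_nonneg) simp
  then show ?thesis by simp
qed

section \<open>Unique solvability of the system\<close>

lemma interpolation_system_iff:
  assumes "m \<ge> 1"
  shows "interpolation_system m x z C \<mu> \<longleftrightarrow>
    (\<forall>k'. (\<Sum>k\<in>UNIV. C $ k * bern (2 * m) (x $ k' - x $ k)) + \<mu> = bern (2 * m) (z - x $ k')) \<and>
    (\<Sum>k\<in>UNIV. C $ k) = 1"
proof -
  have "(\<Sum>k\<in>UNIV. of_real (C $ k) * periodic_B (2 * m) (x $ k' - x $ k)) + of_real \<mu>
      = of_real ((\<Sum>k\<in>UNIV. C $ k * bern (2 * m) (x $ k' - x $ k)) + \<mu>)" for k'
    by (simp add: periodic_B_eq_bern[OF assms])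
  then show ?thesis
    unfolding interpolation_system_def periodic_B_eq_bern[OF assms, of "z - _"] by (simp only: of_real_eq_iff)
qed

text \<open>Linearity passes from powers to all polynomials; the product of \<open>u - w i\<close>
  over \<open>i \<noteq> j\<close> then isolates \<open>c j\<close>.\<close>

lemma vandermonde_kernel:
  fixes c w :: "'i \<Rightarrow> complex"
  assumes "finite I" "inj_on w I" "\<And>n. (\<Sum>k\<in>I. c k * w k ^ n) = 0" "j \<in> I"
  shows "c j = 0"
proof -
  have poly: "(\<Sum>k\<in>I. c k * poly p (w k)) = 0" for p
  proof -
    have "(\<Sum>k\<in>I. c k * poly p (w k)) = (\<Sum>k\<in>I. \<Sum>n\<le>degree p. coeff p n * (c k * w k ^ n))"
      by (simp add: poly_altdef sum_distrib_left mult_ac)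
    also have "\<dots> = (\<Sum>n\<le>degree p. coeff p n * (\<Sum>k\<in>I. c k * w k ^ n))"
      by (subst sum.swap) (simp add: sum_distrib_left)
    finally show ?thesis using assms(3) by simp
  qed
  define p where "p = (\<Prod>i\<in>I - {j}. [:- w i, 1:])"
  have p: "poly p u = (\<Prod>i\<in>I - {j}. u - w i)" for u
    by (simp add: p_def poly_prod)
  have "poly p (w k) = 0" if "k \<in> I - {j}" for k
    using that assms(1) by (auto simp: p prod_zero_iff)
  then have "(\<Sum>k\<in>I. c k * poly p (w k)) = c j * poly p (w j)"
    using assms(1,4) by (simp add: sum.remove[of I j])
  then have "c j * poly p (w j) = 0" using poly by simp
  moreover have "poly p (w j) \<noteq> 0"
    using assms(1,2,4) by (auto simp: p prod_zero_iff inj_on_def)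
  ultimately show ?thesis by simp
qed

lemma cis_eq_imp_diff_Ints:
  assumes "cis (2 * pi * a) = cis (2 * pi * b)"
  shows "a - b \<in> \<int>"
proof -
  have "sin (2 * pi * a) = sin (2 * pi * b) \<and> cos (2 * pi * a) = cos (2 * pi * b)"
    using assms by (simp add: complex_eq_iff)
  then obtain n where "2 * pi * a = 2 * pi * b + 2 * pi * of_int n"
    unfolding sin_cos_eq_iff by blast
  then have "2 * pi * (a - b) = 2 * pi * of_int n" by (simp add: algebra_simps)
  then show ?thesis by simp
qed

lemma bern_even_definite:
  fixes C x :: "real ^ 'n"
  assumes "m \<ge> 1" and dist: "\<And>j k. j \<noteq> k \<Longrightarrow> x $ j - x $ k \<notin> \<int>"
    and C: "(\<Sum>k\<in>UNIV. C $ k) = 0"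
    and Q: "(\<Sum>j\<in>UNIV. \<Sum>k\<in>UNIV. C $ j * C $ k * bern (2 * m) (x $ j - x $ k)) = 0"
  shows "C = 0"
proof -
  define c where "c i = 2 * pi * (real i + 1)" for i
  \<comment> \<open>Real and imaginary parts of the exponential sum at frequency
    \<open>i + 1\<close>.\<close>
  define p q where "p i = (\<Sum>k\<in>UNIV. C $ k * cos (c i * x $ k))" and "q i = (\<Sum>k\<in>UNIV. C $ k * sin (c i * x $ k))" for i
  define T where "T i = 2 / c i ^ (2 * m) * ((p i)\<^sup>2 + (q i)\<^sup>2)" for i
  have c: "c i > 0" for i by (simp add: c_def add_pos_nonneg)
  have pq: "(p i)\<^sup>2 + (q i)\<^sup>2 = (\<Sum>j\<in>UNIV. \<Sum>k\<in>UNIV. C $ j * C $ k * cos (c i * (x $ j - x $ k)))" for i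
    by (simp add: p_def q_def power2_eq_square sum_product sum.distrib[symmetric] right_diff_distrib cos_diff
        algebra_simps)
  have T: "(\<Sum>j\<in>UNIV. \<Sum>k\<in>UNIV. C $ j * C $ k * bern_term (2 * m) i (x $ j - x $ k)) = (-1) ^ m * T i" for i
    unfolding T_def pq bern_term_even c_def[symmetric]
    by (simp add: sum_distrib_left mult_ac)
  have "(\<lambda>i. \<Sum>j\<in>UNIV. \<Sum>k\<in>UNIV. C $ j * C $ k * bern_term (2 * m) i (x $ j - x $ k)) sums
      (\<Sum>j\<in>UNIV. \<Sum>k\<in>UNIV. C $ j * C $ k * bern (2 * m) (x $ j - x $ k))"
    using assms(1) by (intro sums_sum sums_mult bern_term_sums) auto
  then have "(\<lambda>i. (-1) ^ m * T i) sums 0" unfolding T Q .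
  \<comment> \<open>A second factor \<open>(-1) ^ m\<close> cancels the sign and leaves a vanishing
    series of nonnegative terms.\<close>
  from sums_mult[OF this, of "(-1) ^ m"] have "T sums 0"
    by (simp flip: mult.assoc power_mult_distrib)
  moreover have T0: "0 \<le> T i" for i using c[of i] by (simp add: T_def)
  ultimately have "T i = 0" for i
    using suminf_eq_zero_iff[of T] by (simp add: sums_iff)
  then have "(p i)\<^sup>2 + (q i)\<^sup>2 = 0" for i
    using c[of i] unfolding T_def mult_eq_0_iff by force
  then have pq0: "p i = 0" "q i = 0" for i
    by (simp_all add: sum_power2_eq_zero_iff)
  \<comment> \<open>For the powers of \<open>w k\<close>, exponent 0 is the hypothesis on the sum of
    the coefficients, and exponent \<open>i + 1\<close> is the frequency of \<open>p i\<close> and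
    \<open>q i\<close>.\<close>
  define w where "w k = cis (2 * pi * x $ k)" for k
  have "(\<Sum>k\<in>UNIV. of_real (C $ k) * w k ^ n) = 0" for n
  proof (cases n)
    case 0
    then show ?thesis using C by (simp flip: of_real_sum)
  next
    case (Suc i)
    have "w k ^ n = cis (c i * x $ k)" for k
      unfolding w_def Suc Complex.DeMoivre c_def by (simp add: algebra_simps)
    then have "(\<Sum>k\<in>UNIV. of_real (C $ k) * w k ^ n) = Complex (p i) (q i)"
      by (simp add: complex_eq_iff p_def q_def)
    then show ?thesis using pq0 by (simp add: complex_eq_iff)
  qed
  moreover have "inj w"
    using dist cis_eq_imp_diff_Ints by (fastforce simp: inj_def w_def)
  ultimately have "of_real (C $ k) = (0 :: complex)" for k
    using vandermonde_kernel[of UNIV w "\<lambda>k. of_real (C $ k)" k] by simp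
  then show ?thesis by (simp add: vec_eq_iff)
qed

text \<open>The system is square, with the unknown \<open>\<mu>\<close> matching the sum condition,
  so injectivity of its linear part suffices.\<close>

lemma interpolation_system_unique_solution:
  fixes x :: "real ^ 'n"
  assumes "m \<ge> 1" and dist: "\<And>j k. j \<noteq> k \<Longrightarrow> x $ j - x $ k \<notin> \<int>"
  shows "\<exists>!(C, \<mu>). interpolation_system m x z C \<mu>"
proof -
  define T :: "(real ^ 'n) \<times> real \<Rightarrow> (real ^ 'n) \<times> real" where
    "T p = (\<chi> k'. (\<Sum>k\<in>UNIV. fst p $ k * bern (2 * m) (x $ k' - x $ k)) + snd p, \<Sum>k\<in>UNIV. fst p $ k)" for p
  have lin: "linear T"
    by (rule linearI) (simp_all add: T_def vec_eq_iff algebra_simps sum.distrib sum_distrib_left)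
  have inj: "inj T"
    unfolding linear_injective_0[OF lin]
  proof (intro allI impI)
    fix p assume p: "T p = 0"
    obtain C \<mu> where Cm: "p = (C, \<mu>)" by (cases p)
    have 1: "(\<Sum>k\<in>UNIV. C $ k * bern (2 * m) (x $ k' - x $ k)) = - \<mu>" for k'
      using p by (simp add: T_def Cm zero_prod_def vec_eq_iff) (metis add.inverse_unique add.commute)
    have 2: "(\<Sum>k\<in>UNIV. C $ k) = 0" using p by (simp add: T_def Cm zero_prod_def)
    \<comment> \<open>The homogeneous node equations are weighted by \<open>C\<close> and added;
      \<open>\<mu>\<close> drops out because the coefficients sum to 0.\<close>
    have "(\<Sum>j\<in>UNIV. \<Sum>k\<in>UNIV. C $ j * C $ k * bern (2 * m) (x $ j - x $ k)) = (\<Sum>j\<in>UNIV. C $ j * - \<mu>)"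
      by (simp add: mult.assoc 1 flip: sum_distrib_left)
    also have "\<dots> = 0" by (simp only: sum_distrib_right[symmetric] 2 mult_zero_left)
    finally have Q: "(\<Sum>j\<in>UNIV. \<Sum>k\<in>UNIV. C $ j * C $ k * bern (2 * m) (x $ j - x $ k)) = 0" .
    have "C = 0" by (rule bern_even_definite[OF assms(1) _ 2 Q]) (rule dist)
    then show "p = 0" using 1 by (simp add: Cm zero_prod_def)
  qed
  have "surj T" by (rule linear_injective_imp_surjective[OF lin inj refl])
  with inj have ex1: "\<exists>!p. T p = (\<chi> k'. bern (2 * m) (z - x $ k'), 1)"
    by (metis injD surjD)
  have "(\<lambda>(C, \<mu>). interpolation_system m x z C \<mu>) = (\<lambda>p. T p = (\<chi> k'. bern (2 * m) (z - x $ k'), 1))"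
    by (auto simp: fun_eq_iff interpolation_system_iff[OF assms(1)] T_def vec_eq_iff)
  with ex1 show ?thesis by (simp only:)
qed

section \<open>The representer of the error functional and minimality\<close>

definition representer :: "nat \<Rightarrow> real ^ 'n \<Rightarrow> real \<Rightarrow> real ^ 'n \<Rightarrow> real \<Rightarrow> real" where
  "representer m x z C t = bern (2 * m) (t - z) - (\<Sum>k\<in>UNIV. C $ k * bern (2 * m) (t - x $ k))"

text \<open>The factor \<open>(-1) ^ m\<close> collects one sign for each of the \<open>m\<close>
  differentiations of \<open>bern (2 * m)\<close>.\<close>

definition representer_deriv :: "nat \<Rightarrow> real ^ 'n \<Rightarrow> real \<Rightarrow> real ^ 'n \<Rightarrow> real \<Rightarrow> real" where
  "representer_deriv m x z C t = (-1) ^ m * (bern m (t - z) - (\<Sum>k\<in>UNIV. C $ k * bern m (t - x $ k)))"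

lemma representer_periodic: "representer m x z C (t + 1) = representer m x z C t"
proof -
  have "t + 1 - y = (t - y) + 1" for y by simp
  then show ?thesis unfolding representer_def by (simp only: bern_periodic)
qed

lemma has_nth_deriv_representer:
  assumes "m \<ge> 1"
  shows "has_nth_deriv m (representer m x z C) (representer_deriv m x z C)"
proof -
  have b: "has_nth_deriv m (\<lambda>t. bern (2 * m) (t - y)) (\<lambda>t. (-1) ^ m * bern m (t - y))" for y
    using has_nth_deriv_bern[of m "2 * m" y] assms by simp
  have "has_nth_deriv m (\<lambda>t. bern (2 * m) (t - z) + (\<Sum>k\<in>UNIV. - (C $ k) * bern (2 * m) (t - x $ k)))
     (\<lambda>t. (-1) ^ m * bern m (t - z) + (\<Sum>k\<in>UNIV. - (C $ k) * ((-1) ^ m * bern m (t - x $ k))))"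
    by (intro has_nth_deriv_add has_nth_deriv_sum has_nth_deriv_mult b) auto
  then show ?thesis
    by (simp add: representer_def[abs_def] representer_deriv_def[abs_def] sum_negf right_diff_distrib
        sum_distrib_left mult_ac)
qed

text \<open>Each integral against \<open>bern m (t - y)\<close> gives \<open>\<phi> y\<close> minus
  the mean \<open>M\<close>; the means cancel because \<open>z\<close> has weight 1 and the nodes
  have total weight -1.\<close>

lemma representer_deriv_inner:
  fixes x C :: "real ^ 'n"
  assumes "m \<ge> 1" "\<forall>k. x $ k \<in> {0..1}" "z \<in> {0..1}" "(\<Sum>k\<in>UNIV. C $ k) = 1"
    and \<phi>: "has_nth_deriv m \<phi> h" "\<And>t. \<phi> (t + 1) = \<phi> t"
  shows "((\<lambda>t. representer_deriv m x z C t * h t) has_integral (-1) ^ m * error_functional x z C \<phi>) {0..1}"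
proof -
  define M where "M = integral {0..1} \<phi>"
  have b: "((\<lambda>t. bern m (t - y) * h t) has_integral (\<phi> y - M)) {0..1}" if "y \<in> {0..1}" for y
    using integral_bern_mult_deriv[of "m - 1" \<phi> h y] assms(1) \<phi> that by (simp add: M_def)
  have "((\<lambda>t. (-1) ^ m * (bern m (t - z) * h t - (\<Sum>k\<in>UNIV. C $ k * (bern m (t - x $ k) * h t)))) has_integral
      (-1) ^ m * (\<phi> z - M - (\<Sum>k\<in>UNIV. C $ k * (\<phi> (x $ k) - M)))) {0..1}"
    using assms(2,3) by (intro has_integral_mult_right has_integral_diff has_integral_sum b) auto
  moreover have "(\<Sum>k\<in>UNIV. C $ k * (\<phi> (x $ k) - M)) = (\<Sum>k\<in>UNIV. C $ k * \<phi> (x $ k)) - M"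
    using assms(4) by (simp add: right_diff_distrib sum_subtractf flip: sum_distrib_right)
  moreover have "(-1) ^ m * (bern m (t - z) * h t - (\<Sum>k\<in>UNIV. C $ k * (bern m (t - x $ k) * h t)))
      = representer_deriv m x z C t * h t" for t
    by (simp add: representer_deriv_def left_diff_distrib sum_distrib_right mult.assoc)
  ultimately show ?thesis
    by (simp add: error_functional_def)
qed

text \<open>Since \<open>bern (2 * m)\<close> is even, the node equations say that the representer
  of \<open>C\<close> equals \<open>\<mu>\<close> at every node. The value obtained does not depend
  on \<open>D\<close>, which is what makes \<open>C\<close> optimal.\<close>

lemma error_functional_representer:
  assumes "m \<ge> 1" "interpolation_system m x z C \<mu>" "(\<Sum>k\<in>UNIV. D $ k) = 1"
  shows "error_functional x z D (representer m x z C) = representer m x z C z - \<mu>"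
proof -
  have "representer m x z C (x $ k) = \<mu>" for k
  proof -
    have "(\<Sum>j\<in>UNIV. C $ j * bern (2 * m) (x $ k - x $ j)) + \<mu> = bern (2 * m) (z - x $ k)"
      using assms(2) unfolding interpolation_system_iff[OF assms(1)] by blast
    then show ?thesis
      using bern_even_uminus[of m "z - x $ k"] by (simp add: representer_def)
  qed
  then show ?thesis
    using assms(3) by (simp add: error_functional_def flip: sum_distrib_right)
qed

lemma dual_norm_error_functional_minimal:
  fixes x C D :: "real ^ 'n"
  assumes m: "m \<ge> 1" and xz: "\<forall>k. x $ k \<in> {0..1}" "z \<in> {0..1}"
    and sys: "interpolation_system m x z C \<mu>" and D: "(\<Sum>k\<in>UNIV. D $ k) = 1"
  shows "dual_norm m (error_functional x z C) \<le> dual_norm m (error_functional x z D)"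
proof -
  define \<psi> G where "\<psi> = representer m x z C" and "G = representer_deriv m x z C"
  \<comment> \<open>\<open>Q\<close> is the squared norm of \<open>\<psi>\<close>, as testing
    \<open>inner\<close> with \<open>\<psi>\<close> itself shows.\<close>
  define Q where "Q = (-1) ^ m * error_functional x z C \<psi>"
  have C: "(\<Sum>k\<in>UNIV. C $ k) = 1" using sys by (simp add: interpolation_system_def)
  have inner: "((\<lambda>t. G t * h t) has_integral (-1) ^ m * error_functional x z C \<phi>) {0..1}"
    if "has_nth_deriv m \<phi> h" "\<And>t. \<phi> (t + 1) = \<phi> t" for \<phi> h
    unfolding G_def by (rule representer_deriv_inner[OF m xz C that])
  have \<psi>: "has_nth_deriv m \<psi> G" "\<And>t. \<psi> (t + 1) = \<psi> t"
    using has_nth_deriv_representer[OF m] by (auto simp: \<psi>_def G_def representer_periodic)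
  have G: "((\<lambda>t. (G t)\<^sup>2) has_integral Q) {0..1}"
    using inner[OF \<psi>] by (simp add: power2_eq_square Q_def)
  then have Q0: "0 \<le> Q" by (rule has_integral_nonneg) simp
  have "dual_norm m (error_functional x z C) \<le> ennreal (sqrt Q)"
    unfolding dual_norm_def
  proof (intro SUP_least ennreal_leI)
    fix \<phi> assume "\<phi> \<in> {\<phi> \<in> periodic_sobolev m. sobolev_norm m \<phi> = 1}"
    then obtain g where \<phi>: "\<And>t. \<phi> (t + 1) = \<phi> t" "has_nth_deriv m \<phi> g"
      "(\<lambda>t. (nth_deriv m \<phi> t)\<^sup>2) integrable_on {0..1}" "sobolev_norm m \<phi> = 1"
      by (auto simp: periodic_sobolev_def)
    have "((\<lambda>t. (nth_deriv m \<phi> t)\<^sup>2) has_integral 1) {0..1}"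
      using \<phi>(3,4) by (simp add: sobolev_norm_def has_integral_iff)
    from has_integral_Cauchy_Schwarz_unit[OF G this inner[OF has_nth_deriv_nth_deriv[OF \<phi>(2)] \<phi>(1)]]
    have "(error_functional x z C \<phi>)\<^sup>2 \<le> Q" by (simp add: power_mult_distrib flip: power_mult)
    then show "\<bar>error_functional x z C \<phi>\<bar> \<le> sqrt Q" by (metis real_sqrt_abs real_sqrt_le_mono)
  qed
  \<comment> \<open>If \<open>Q > 0\<close>, \<open>\<psi>\<close> divided by \<open>sqrt Q\<close>
    is an admissible test function at which the functional of \<open>D\<close>, like that of
    \<open>C\<close>, has absolute value \<open>sqrt Q\<close>.\<close>
  also have "ennreal (sqrt Q) \<le> dual_norm m (error_functional x z D)"
  proof (cases "Q = 0")
    case False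
    then have Q: "Q > 0" using Q0 by simp
    define \<phi> where "\<phi> t = 1 / sqrt Q * \<psi> t" for t
    have \<phi>: "has_nth_deriv m \<phi> (\<lambda>t. 1 / sqrt Q * G t)"
      unfolding \<phi>_def by (rule has_nth_deriv_mult[OF \<psi>(1)])
    have "((\<lambda>t. 1 / Q * (G t)\<^sup>2) has_integral 1 / Q * Q) {0..1}"
      by (rule has_integral_mult_right[OF G])
    then have "((\<lambda>t. (1 / sqrt Q * G t)\<^sup>2) has_integral 1) {0..1}"
      using Q by (simp add: power_mult_distrib power_divide)
    then have int: "((\<lambda>t. (nth_deriv m \<phi> t)\<^sup>2) has_integral 1) {0..1}"
      by (simp only: has_integral_nth_deriv_square[OF m \<phi>])
    have "\<phi> \<in> {\<phi> \<in> periodic_sobolev m. sobolev_norm m \<phi> = 1}"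
      using int \<phi> \<psi>(2) by (auto simp: periodic_sobolev_def sobolev_norm_def has_integral_iff \<phi>_def)
    moreover have "\<bar>error_functional x z D \<phi>\<bar> = sqrt Q"
    proof -
      have "error_functional x z D \<phi> = 1 / sqrt Q * error_functional x z D \<psi>"
        by (simp add: error_functional_def \<phi>_def right_diff_distrib diff_divide_distrib sum_divide_distrib)
      also have "error_functional x z D \<psi> = error_functional x z C \<psi>"
        using error_functional_representer[OF m sys] C D by (simp add: \<psi>_def)
      also have "\<bar>1 / sqrt Q * error_functional x z C \<psi>\<bar> = \<bar>Q\<bar> / sqrt Q"
        using Q by (simp add: Q_def abs_mult power_abs)
      finally show ?thesis using Q by (simp add: real_div_sqrt)
    qed
    ultimately show ?thesis
      unfolding dual_norm_def by (metis (mono_tags, lifting) SUP_upper)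
  qed simp
  finally show ?thesis .
qed

text \<open>Nodes are taken distinct modulo 1, because 1-periodic functions cannot separate points
  that differ by an integer: the nodes 0 and 1 would give two equal columns of the system.\<close>

theorem mainTheorem3:
  fixes m :: nat and x :: "real ^ 'n" and z :: real
  assumes "1 \<le> m"
    and "\<forall>k. x $ k \<in> {0..1}"
    and "\<forall>j k. j \<noteq> k \<longrightarrow> x $ j - x $ k \<notin> \<int>"
    and "z \<in> {0..1}"
  shows "(\<exists>!(C, \<mu>). interpolation_system m x z C \<mu>) \<and>
    (\<forall>C \<mu>. interpolation_system m x z C \<mu> \<longrightarrow>
       is_arg_min (\<lambda>C. (dual_norm m (error_functional x z C))\<^sup>2) (\<lambda>C. (\<Sum>k\<in>UNIV. C $ k) = 1) C)"
proof (intro conjI allI impI)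
  show "\<exists>!(C, \<mu>). interpolation_system m x z C \<mu>"
    using assms(1,3) by (intro interpolation_system_unique_solution) auto
  fix C \<mu> assume sys: "interpolation_system m x z C \<mu>"
  have "(dual_norm m (error_functional x z C))\<^sup>2 \<le> (dual_norm m (error_functional x z D))\<^sup>2"
    if "(\<Sum>k\<in>UNIV. D $ k) = 1" for D
    by (intro power_mono dual_norm_error_functional_minimal[OF assms(1,2,4) sys that]) simp
  then show "is_arg_min (\<lambda>C. (dual_norm m (error_functional x z C))\<^sup>2) (\<lambda>C. (\<Sum>k\<in>UNIV. C $ k) = 1) C"
    using sys by (auto simp: is_arg_min_def interpolation_system_def simp flip: not_le)
qed

end
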